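(* Consider $\min_{\mathbf{x}\in\mathbb{R}^d}\max_{\mathbf{y}\in\mathcal{Y}}f(\mathbf{x},\mathbf{y})$ and $F(\mathbf{x})=\max_{\mathbf{y}\in\mathcal{Y}}f(\mathbf{x},\mathbf{y})$, under the following assumptions. (i) $F$ is differentiable with $L_F$-Lipschitz gradient and $\nabla f$ is $L_f$-Lipschitz continuous in $(\mathbf{x},\mathbf{y})$. (ii) There is an unbiased stochastic oracle $(\mathcal{O}_{x}(\mathbf{x},\mathbf{y}),\mathcal{O}_{y}(\mathbf{x},\mathbf{y}))$ with $\mathrm{E}[\mathcal{O}_{x}(\mathbf{x},\mathbf{y})]=\nabla_xf(\mathbf{x},\mathbf{y})$, $\mathrm{E}[\mathcal{O}_{y}(\mathbf{x},\mathbf{y})]=\nabla_yf(\mathbf{x},\mathbf{y})$, $\mathrm{E}\|\mathcal{O}_{x}(\mathbf{x},\mathbf{y})-\nabla_xf(\mathbf{x},\mathbf{y})\|^2\le\sigma^2$ and $\mathrm{E}\|\mathcal{O}_{y}(\mathbf{x},\mathbf{y})-\nabla_yf(\mathbf{x},\mathbf{y})\|^2\le\sigma^2$. (iii) Either $\mathcal{Y}\subseteq\mathbb{R}^{d'}$ is a (bounded or unbounded) closed convex set and $f(\mathbf{x},\cdot)$ is $\lambda$-strongly concave for every $\mathbf{x}$; or $\mathcal{Y}=\mathbb{R}^{d'}$ and for every $\mathbf{x}$, $f(\mathbf{x},\cdot)$ is concave and satisfies the dual-side $\lambda$-PL condition $\|\nabla_yf(\mathbf{x},\mathbf{y})\|^2\ge2\lambda(\max_{\mathbf{y}'}f(\mathbf{x},\mathbf{y}')-f(\mathbf{x},\mathbf{y}))$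 for all $\mathbf{y}$ (here $\lambda>0$). (iv) $F(\mathbf{x}_0)-\min_{\mathbf{x}}F(\mathbf{x})\le\Delta_F$. Run the primal-dual algorithm PDSM/PDAda described in the context and suppose its coordinate-wise scaling factors satisfy $c_l\le\mathbf{s}_{t,i}\le c_u$ for all $i,t$, for some constants $0<c_l<c_u$. Let $\kappa=L_f/\lambda$, $\Delta_{x,t}=\|\mathbf{v}_{t+1}-\nabla_xf(\mathbf{x}_t,\mathbf{y}_t)\|^2$ and $\delta_{y,t}=\|\mathbf{y}_t-\mathbf{y}^*(\mathbf{x}_t)\|^2$, where $\mathbf{y}^*(\mathbf{x})\in\arg\max_{\mathbf{y}'\in\mathcal{Y}}f(\mathbf{x},\mathbf{y}')$. Then, for all sufficiently large $T$, with $1-\beta=\gamma$ of order $\sqrt{\kappa}/\sqrt{T}$, $\eta_x$ of order $1/(\kappa^{3/2}\sqrt{T})$ and $\eta_y$ of order $\sqrt{\kappa}/\sqrt{T}$ (with suitable proportionality constants independent of $T$ and $\kappa$), $$\mathrm{E}\Big[\frac{1}{T+1}\sum_{t=0}^T\|\nabla F(\mathbf{x}_t)\|^2\Big]\le O\Big(\frac{\kappa^{3/2}}{\sqrt{T}}\Big),\qquad \mathrm{E}\Big[\frac{1}{T+1}\sum_{t=0}^T\big(\Delta_{x,t}+L_f^2\delta_{y,t}\big)\Big]\le O\Big(\frac{\kappa^{3/2}}{\sqrt{T}}\Big),$$ where the constants hidden in $O(\cdot)$ do not depend on $T$ or $\kappa$ (they may depend on $L_f,\sigma,c_l,c_u,\Delta_F$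 and on the initial errors $\mathrm{E}\|\mathbf{v}_1-\nabla F(\mathbf{x}_0)\|^2$ and $\mathrm{E}[\delta_{y,0}]$).
   Context: PDSM/PDAda: given $\mathbf{x}_0,\mathbf{v}_0\in\mathbb{R}^d$, $\mathbf{y}_0\in\mathcal{Y}$, $\beta$, step sizes $\eta_x,\eta_y>0$, and a constant $G_0\ge0$, for $t=0,\dots,T$: $$\mathbf{v}_{t+1}=\beta\mathbf{v}_t+(1-\beta)\mathcal{O}_x(\mathbf{x}_t,\mathbf{y}_t),\quad \mathbf{u}_{t+1}=h_t(\{\mathcal{O}_x(\mathbf{x}_j,\mathbf{y}_j)\}_{j=0}^t),$$ $$\mathbf{x}_{t+1}=\mathbf{x}_t-\eta_x\,\mathbf{s}_t\circ\mathbf{v}_{t+1},\quad \mathbf{y}_{t+1}=\Pi_{\mathcal{Y}}[\mathbf{y}_t+\eta_y\mathcal{O}_y(\mathbf{x}_t,\mathbf{y}_t)],$$ where $h_t$ is any function with values in coordinate-wise nonnegative vectors, $\mathbf{s}_t=1/(\sqrt{\mathbf{u}_{t+1}}+G_0)$ (coordinate-wise) with $i$-th coordinate $\mathbf{s}_{t,i}$, $\circ$ is the coordinate-wise product, and $\Pi_{\mathcal{Y}}$ is Euclidean projection onto $\mathcal{Y}$. Oracle calls at iteration $t$ use fresh randomness, so the mean and variance conditions hold conditionally on everything before iteration $t$. Convention: in the strongly concave case $\mathbf{y}^*(\mathbf{x})$ is the unique maximizer. In the PL case the maximizer may be non-unique, and the statement about $\delta_{y,t}$ is understood for a suitable selection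 (possibly depending on the trajectory) of maximizers $\mathbf{y}^*(\mathbf{x}_t)\in\arg\max_{\mathbf{y}'}f(\mathbf{x}_t,\mathbf{y}')$. Maximizers and the minimum of $F$ are assumed to exist. $\|\cdot\|$ is the Euclidean norm. *)

theory Defs
  imports "HOL-Probability.Probability"
begin

definition primal_function :: "('a \<Rightarrow> 'b \<Rightarrow> real) \<Rightarrow> 'b set \<Rightarrow> 'a \<Rightarrow> real" where
  "primal_function f Y x = (SUP y\<in>Y. f x y)"

definition strongly_concave_on :: "real \<Rightarrow> 'b::real_normed_vector set \<Rightarrow> ('b \<Rightarrow> real) \<Rightarrow> bool" where
  "strongly_concave_on \<mu> S g \<longleftrightarrow> convex S \<and>
     (\<forall>a\<in>S. \<forall>b\<in>S. \<forall>s\<in>{0..1}.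
        g (s *\<^sub>R a + (1 - s) *\<^sub>R b) \<ge>
        s * g a + (1 - s) * g b + \<mu> / 2 * s * (1 - s) * (norm (a - b))\<^sup>2)"

definition dual_PL :: "real \<Rightarrow> ('a \<Rightarrow> 'b \<Rightarrow> real) \<Rightarrow> ('a \<Rightarrow> 'b \<Rightarrow> 'b::real_normed_vector) \<Rightarrow> 'a \<Rightarrow> bool" where
  "dual_PL \<mu> f grad_y x \<longleftrightarrow>
     (\<forall>y. (norm (grad_y x y))\<^sup>2 \<ge> 2 * \<mu> * (primal_function f UNIV x - f x y))"

text \<open>The gradient is taken relative to \<open>UNIV \<times> Y\<close>, so \<open>f\<close> need not be differentiable, nor its
  gradient Lipschitz, outside the feasible set. The norm on pairs is the Euclidean one.\<close>

definition has_gradient_on ::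
  "(real^'d \<Rightarrow> real^'e \<Rightarrow> real) \<Rightarrow> (real^'d \<Rightarrow> real^'e \<Rightarrow> real^'d) \<Rightarrow>
   (real^'d \<Rightarrow> real^'e \<Rightarrow> real^'e) \<Rightarrow> (real^'e) set \<Rightarrow> bool" where
  "has_gradient_on f grad_x grad_y Y \<longleftrightarrow>
     (\<forall>x. \<forall>y\<in>Y. ((\<lambda>z. f (fst z) (snd z)) has_derivative
        (\<lambda>k. grad_x x y \<bullet> fst k + grad_y x y \<bullet> snd k)) (at (x, y) within UNIV \<times> Y))"

text \<open>Given the sub-sigma-algebra \<open>F\<close>, the random vector \<open>g\<close> has conditional mean \<open>m\<close> and
  conditional variance at most \<open>\<sigma>\<^sup>2\<close>. The conditional variance is taken as an extended
  nonnegative real, so its finiteness is part of the bound.\<close>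

definition cond_unbiased ::
  "'w measure \<Rightarrow> 'w measure \<Rightarrow> real \<Rightarrow> ('w \<Rightarrow> real^'n) \<Rightarrow> ('w \<Rightarrow> real^'n) \<Rightarrow> bool" where
  "cond_unbiased M F \<sigma> g m \<longleftrightarrow>
     integrable M g \<and>
     (\<forall>i. AE \<omega> in M. real_cond_exp M F (\<lambda>\<omega>. g \<omega> $ i) \<omega> = m \<omega> $ i) \<and>
     (AE \<omega> in M. nn_cond_exp M F (\<lambda>\<omega>. ennreal ((norm (g \<omega> - m \<omega>))\<^sup>2)) \<omega> \<le> ennreal (\<sigma>\<^sup>2))"

definition scaling :: "real \<Rightarrow> real^'d \<Rightarrow> real^'d" where
  "scaling G\<^sub>0 u = (\<chi> i. 1 / (sqrt (u $ i) + G\<^sub>0))"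

text \<open>A run of iterations \<open>0,\<dots>,T\<close>. The sigma-algebra \<open>F t\<close> contains everything before iteration
  \<open>t\<close>, and \<open>Ox t \<omega>\<close>, \<open>Oy t \<omega>\<close> are the realisations of the oracle used in iteration \<open>t\<close>.
  No measurability of \<open>h t\<close> itself is assumed, only that \<open>u\<close> is adapted; the iterates
  \<open>x\<close>, \<open>y\<close>, \<open>v\<close> are then adapted as well. The product of two vectors in the update of \<open>x\<close> is
  the coordinate-wise one.\<close>

locale pdsm_run =
  prob_space M + filtration "space M" F
  for M :: "'w measure" and F :: "nat \<Rightarrow> 'w measure" +
  fixes Y :: "(real^'e) set"
    and grad_x :: "real^'d \<Rightarrow> real^'e \<Rightarrow> real^'d"
    and grad_y :: "real^'d \<Rightarrow> real^'e \<Rightarrow> real^'e"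
    and \<sigma> :: real
    and x\<^sub>0 v\<^sub>0 :: "real^'d" and y\<^sub>0 :: "real^'e"
    and \<beta> \<eta>\<^sub>x \<eta>\<^sub>y G\<^sub>0 c\<^sub>l c\<^sub>u :: real
    and T :: nat
    and Ox :: "nat \<Rightarrow> 'w \<Rightarrow> real^'d \<Rightarrow> real^'e \<Rightarrow> real^'d"
    and Oy :: "nat \<Rightarrow> 'w \<Rightarrow> real^'d \<Rightarrow> real^'e \<Rightarrow> real^'e"
    and h :: "nat \<Rightarrow> (real^'d) list \<Rightarrow> real^'d"
    and x v u :: "nat \<Rightarrow> 'w \<Rightarrow> real^'d" and y :: "nat \<Rightarrow> 'w \<Rightarrow> real^'e"
  assumes F_sub: "\<And>t. subalgebra M (F t)"
    and Ox_adapted: "\<And>t. t \<le> T \<Longrightarrow> (\<lambda>\<omega>. Ox t \<omega> (x t \<omega>) (y t \<omega>)) \<in> borel_measurable (F (Suc t))"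
    and Oy_adapted: "\<And>t. t \<le> T \<Longrightarrow> (\<lambda>\<omega>. Oy t \<omega> (x t \<omega>) (y t \<omega>)) \<in> borel_measurable (F (Suc t))"
    and u_adapted: "\<And>t. t \<le> T \<Longrightarrow> u (Suc t) \<in> borel_measurable (F (Suc t))"
    and Ox_unbiased: "\<And>t. t \<le> T \<Longrightarrow>
      cond_unbiased M (F t) \<sigma> (\<lambda>\<omega>. Ox t \<omega> (x t \<omega>) (y t \<omega>)) (\<lambda>\<omega>. grad_x (x t \<omega>) (y t \<omega>))"
    and Oy_unbiased: "\<And>t. t \<le> T \<Longrightarrow>
      cond_unbiased M (F t) \<sigma> (\<lambda>\<omega>. Oy t \<omega> (x t \<omega>) (y t \<omega>)) (\<lambda>\<omega>. grad_y (x t \<omega>) (y t \<omega>))"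
    and h_nonneg: "\<And>t gs i. 0 \<le> h t gs $ i"
    and init: "\<And>\<omega>. \<omega> \<in> space M \<Longrightarrow> x 0 \<omega> = x\<^sub>0 \<and> v 0 \<omega> = v\<^sub>0 \<and> y 0 \<omega> = y\<^sub>0"
    and v_step: "\<And>t \<omega>. t \<le> T \<Longrightarrow> \<omega> \<in> space M \<Longrightarrow>
      v (Suc t) \<omega> = \<beta> *\<^sub>R v t \<omega> + (1 - \<beta>) *\<^sub>R Ox t \<omega> (x t \<omega>) (y t \<omega>)"
    and u_step: "\<And>t \<omega>. t \<le> T \<Longrightarrow> \<omega> \<in> space M \<Longrightarrow>
      u (Suc t) \<omega> = h t (map (\<lambda>j. Ox j \<omega> (x j \<omega>) (y j \<omega>)) [0..<Suc t])"
    and x_step: "\<And>t \<omega>. t \<le> T \<Longrightarrow> \<omega> \<in> space M \<Longrightarrow>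
      x (Suc t) \<omega> = x t \<omega> - \<eta>\<^sub>x *\<^sub>R (scaling G\<^sub>0 (u (Suc t) \<omega>) * v (Suc t) \<omega>)"
    and y_step: "\<And>t \<omega>. t \<le> T \<Longrightarrow> \<omega> \<in> space M \<Longrightarrow>
      y (Suc t) \<omega> = closest_point Y (y t \<omega> + \<eta>\<^sub>y *\<^sub>R Oy t \<omega> (x t \<omega>) (y t \<omega>))"
    and scaling_bounds: "\<And>t i. t \<le> T \<Longrightarrow>
      AE \<omega> in M. c\<^sub>l \<le> scaling G\<^sub>0 (u (Suc t) \<omega>) $ i \<and> scaling G\<^sub>0 (u (Suc t) \<omega>) $ i \<le> c\<^sub>u"

text \<open>The proportionality constant of \<open>\<eta>\<^sub>x\<close> and the constant hidden in \<open>O(\<cdot>)\<close>. They are given in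
  closed form because an existential quantifier under the type variables of the two spaces would
  allow them to depend on the dimensions. The parameter \<open>\<kappa>\<^sub>0\<close> is any positive lower bound on the
  condition numbers considered, and \<open>D\<^sub>v\<close>, \<open>D\<^sub>y\<close> bound the initial errors
  (\<open>v 1\<close> depends on \<open>\<beta>\<close> and hence on \<open>T\<close>, so a bound is needed rather than the value). Here
  \<open>\<kappa>\<^sub>0 = 1\<close> will do unless \<open>Y\<close> is a singleton or, in the PL case,
  \<open>f\<close> does not depend on \<open>y\<close>; there \<open>\<kappa>\<close> can be arbitrarily small, and no constant is uniform as
  \<open>\<kappa>\<close> tends to 0.\<close>

definition step_const :: "real \<Rightarrow> real \<Rightarrow> real \<Rightarrow> real \<Rightarrow> real" where
  "step_const \<kappa>\<^sub>0 L\<^sub>f c\<^sub>l c\<^sub>u =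
     sqrt (c\<^sub>l / (c\<^sub>u ^ 3 * (2 ^ 14 + 64 * (1 + 1 / \<kappa>\<^sub>0) ^ 4 * L\<^sub>f\<^sup>2)))"

definition rate_const ::
  "real \<Rightarrow> real \<Rightarrow> real \<Rightarrow> real \<Rightarrow> real \<Rightarrow> real \<Rightarrow> real \<Rightarrow> real \<Rightarrow> real" where
  "rate_const \<kappa>\<^sub>0 L\<^sub>f \<sigma> c\<^sub>l c\<^sub>u \<Delta>\<^sub>F D\<^sub>v D\<^sub>y =
     (let K = 1 + 1 / \<kappa>\<^sub>0 in
      16 * (c\<^sub>u / c\<^sub>l) *
        (64 * (K\<^sup>2 * D\<^sub>v + K * \<sigma>\<^sup>2 + K * L\<^sub>f * D\<^sub>y + L\<^sub>f * \<sigma>\<^sup>2)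
         + \<Delta>\<^sub>F / (c\<^sub>u * step_const \<kappa>\<^sub>0 L\<^sub>f c\<^sub>l c\<^sub>u)))"

lemma step_const_pos:
  assumes "0 < c\<^sub>l" "0 < c\<^sub>u"
  shows "0 < step_const \<kappa>\<^sub>0 L\<^sub>f c\<^sub>l c\<^sub>u"
proof -
  have "(0::real) < 2 ^ 14 + 64 * (1 + 1 / \<kappa>\<^sub>0) ^ 4 * L\<^sub>f\<^sup>2"
    by (intro add_pos_nonneg mult_nonneg_nonneg) auto
  then show ?thesis
    unfolding step_const_def using assms by simp
qed

end

theory Submission
  imports Defs
begin

text \<open>Let \<open>p t\<close> be the maximizer of \<open>f (x t)\<close> closest to \<open>y t\<close>. In both alternatives of the assumption
  on \<open>Y\<close> and \<open>f\<close>, \<open>grad_y\<close> is strongly monotone towards \<open>p t\<close> and the set of maximizers is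
  Lipschitz in \<open>x\<close> with constant \<open>2\<kappa>\<close> for the Hausdorff distance. Hence the dual error
  \<open>D t = E[norm (y t - p t)^2]\<close> and the momentum error \<open>A t = E[norm (v (t+1) - grad_F (x t))^2]\<close>
  both contract, up to noise and to a drift proportional to \<open>\<eta>\<^sub>x\<^sup>2 * B t\<close>, where
  \<open>B t = E[norm (v (t+1))^2]\<close>. The descent inequality for the primal function, summed along each
  path, bounds \<open>E[norm (grad_F (x t))^2] + B t / 2\<close> on average by the initial gap and
  \<open>c\<^sub>u / c\<^sub>l\<close> times the average of \<open>A\<close>. The constant in \<open>\<eta>\<^sub>x\<close> is small enough for the term
  \<open>B t / 2\<close> to absorb the drift.\<close>

subsection \<open>Concave maximization on a convex set\<close>

text \<open>The scaling vector of iteration \<open>t\<close> is built from the oracle call of the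
  same iteration, so it is correlated with the noise in \<open>v (t+1)\<close>. The descent
  inequality is therefore kept pathwise and uses only the bounds \<open>c\<^sub>l\<close> and
  \<open>c\<^sub>u\<close>; unbiasedness enters only through \<open>A\<close> and \<open>D\<close>,
  where the scaling appears just as a bound on the step of \<open>x\<close>. Comparing the momentum
  with \<open>grad_F (x t)\<close> instead of \<open>grad_x (x t) (y t)\<close> makes its target
  drift with \<open>x\<close> alone, at the price of a bias \<open>L\<^sub>f^2 * D\<close>. The
  orders of the step sizes come from the dual error: its summed recursion carries the sum of
  \<open>B\<close> into that of \<open>L\<^sub>f^2 * D\<close> with a factor of order
  \<open>(\<kappa>^2 * \<eta>\<^sub>x / \<eta>\<^sub>y)^2\<close>, which forces
  \<open>\<eta>\<^sub>x\<close> to be of order \<open>\<eta>\<^sub>y / \<kappa>^2\<close>. On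
  average the noise is then of order \<open>\<kappa> * \<eta>\<^sub>y\<close> and the initial gap of
  order \<open>\<kappa>^2 / (\<eta>\<^sub>y * T)\<close>; they balance at
  \<open>\<eta>\<^sub>y\<close> of order \<open>sqrt (\<kappa> / T)\<close>.\<close>

lemma has_derivative_segment_quotient:
  fixes g :: "'a::real_inner \<Rightarrow> real"
  assumes "(g has_derivative (\<lambda>h. D \<bullet> h)) (at a within S)" "convex S" "a \<in> S" "b \<in> S"
  shows "((\<lambda>s. (g (a + s *\<^sub>R (b - a)) - g a) / s) \<longlongrightarrow> D \<bullet> (b - a)) (at_right 0)"
proof -
  have img: "(\<lambda>s. a + s *\<^sub>R (b - a)) ` {0..1} \<subseteq> S"
  proof (rule image_subsetI)
    fix s :: real assume "s \<in> {0..1}"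
    then show "a + s *\<^sub>R (b - a) \<in> S"
      using convexD_alt[OF assms(2,3,4), of s] by (simp add: algebra_simps)
  qed
  have "((\<lambda>s. g (a + s *\<^sub>R (b - a))) has_derivative (\<lambda>s. D \<bullet> (s *\<^sub>R (b - a)))) (at 0 within {0..1})"
  proof (rule has_derivative_in_compose[where g' = "\<lambda>h. D \<bullet> h"])
    show "((\<lambda>s. a + s *\<^sub>R (b - a)) has_derivative (\<lambda>s. s *\<^sub>R (b - a))) (at 0 within {0..1})"
      by (auto intro!: derivative_eq_intros)
    show "(g has_derivative (\<lambda>h. D \<bullet> h)) (at (a + 0 *\<^sub>R (b - a)) within (\<lambda>s. a + s *\<^sub>R (b - a)) ` {0..1})"
      using has_derivative_subset[OF assms(1) img] by simp
  qed
  then have "((\<lambda>s. g (a + s *\<^sub>R (b - a))) has_field_derivative (D \<bullet> (b - a))) (at 0 within {0..1})"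
    by (simp add: has_field_derivative_def mult_commute_abs)
  then show ?thesis
    by (simp add: has_field_derivative_iff at_within_Icc_at_right)
qed

text \<open>Divide the strong concavity inequality on the segment from \<open>a\<close> to
  \<open>b\<close> by \<open>s\<close> and let \<open>s\<close> tend to 0 from the right. The sign
  of \<open>m\<close> is free, so \<open>m = 0\<close> covers plain concavity.\<close>

lemma strongly_concave_on_upper_model:
  fixes g :: "'a::real_inner \<Rightarrow> real"
  assumes conc: "strongly_concave_on m S g"
    and deriv: "(g has_derivative (\<lambda>h. D \<bullet> h)) (at a within S)" and ab: "a \<in> S" "b \<in> S"
  shows "g b \<le> g a + D \<bullet> (b - a) - m / 2 * (norm (b - a))\<^sup>2"
proof -
  have "convex S" using conc by (simp add: strongly_concave_on_def)
  note lim = has_derivative_segment_quotient[OF deriv this ab]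
  have "((\<lambda>s. (g b - g a) + m / 2 * (1 - s) * (norm (b - a))\<^sup>2) \<longlongrightarrow>
      (g b - g a) + m / 2 * (1 - 0) * (norm (b - a))\<^sup>2) (at_right (0::real))"
    by (intro tendsto_intros)
  moreover have "eventually (\<lambda>s. (g b - g a) + m / 2 * (1 - s) * (norm (b - a))\<^sup>2
      \<le> (g (a + s *\<^sub>R (b - a)) - g a) / s) (at_right (0::real))"
  proof (rule eventually_at_rightI[of 0 1])
    fix s :: real assume s: "s \<in> {0<..<1}"
    have "g (s *\<^sub>R b + (1 - s) *\<^sub>R a) \<ge> s * g b + (1 - s) * g a + m / 2 * s * (1 - s) * (norm (b - a))\<^sup>2"
      using conc ab s unfolding strongly_concave_on_def by auto
    moreover have "s *\<^sub>R b + (1 - s) *\<^sub>R a = a + s *\<^sub>R (b - a)" by (simp add: algebra_simps)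
    ultimately have "s * ((g b - g a) + m / 2 * (1 - s) * (norm (b - a))\<^sup>2) \<le> g (a + s *\<^sub>R (b - a)) - g a"
      by (simp add: algebra_simps)
    then show "(g b - g a) + m / 2 * (1 - s) * (norm (b - a))\<^sup>2 \<le> (g (a + s *\<^sub>R (b - a)) - g a) / s"
      using s by (simp add: pos_le_divide_eq mult.commute)
  qed simp
  ultimately show ?thesis
    using tendsto_le[OF _ lim] by (fastforce simp: trivial_limit_at_right_real)
qed

text \<open>The difference quotients from \<open>p\<close> towards a feasible point are nonpositive.
  In this form first-order optimality also covers maximizers on the boundary of
  \<open>S\<close>.\<close>

lemma maximizer_variational_inequality:
  fixes g :: "'a::real_inner \<Rightarrow> real"
  assumes max: "\<And>z. z \<in> S \<Longrightarrow> g z \<le> g p" and "convex S"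
    and deriv: "(g has_derivative (\<lambda>h. D \<bullet> h)) (at p within S)" and pz: "p \<in> S" "z \<in> S"
  shows "D \<bullet> (z - p) \<le> 0"
proof -
  note lim = has_derivative_segment_quotient[OF deriv \<open>convex S\<close> pz]
  have "eventually (\<lambda>s. (g (p + s *\<^sub>R (z - p)) - g p) / s \<le> 0) (at_right (0::real))"
  proof (rule eventually_at_rightI[of 0 1])
    fix s :: real assume s: "s \<in> {0<..<1}"
    have "p + s *\<^sub>R (z - p) \<in> S"
      using convexD_alt[OF \<open>convex S\<close> pz, of s] s by (simp add: algebra_simps)
    from max[OF this] s show "(g (p + s *\<^sub>R (z - p)) - g p) / s \<le> 0"
      by (simp add: divide_le_0_iff)
  qed simp
  then show ?thesis
    using tendsto_le[OF _ tendsto_const lim] by (simp add: trivial_limit_at_right_real)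
qed

text \<open>An Ekeland-type argument: under the PL inequality the slope of \<open>sqrt (m - g)\<close> is at least
  \<open>sqrt (\<mu> / 2)\<close> outside the set of maximizers, so a minimizer of \<open>sqrt (m - g z) + c * norm (z - y)\<close>
  with \<open>c < sqrt (\<mu> / 2)\<close> has to be a maximizer of \<open>g\<close>.\<close>

lemma PL_maximizer_near:
  fixes g :: "'a::euclidean_space \<Rightarrow> real"
  assumes deriv: "\<And>z. (g has_derivative (\<lambda>h. D z \<bullet> h)) (at z)"
    and le: "\<And>z. g z \<le> m"
    and PL: "\<And>z. (norm (D z))\<^sup>2 \<ge> 2 * \<mu> * (m - g z)"
    and c: "0 < c" "c\<^sup>2 < \<mu> / 2"
  shows "\<exists>z. g z = m \<and> c * norm (z - y) \<le> sqrt (m - g y)"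
proof -
  define \<phi> where "\<phi> = (\<lambda>z. sqrt (m - g z))"
  define \<psi> where "\<psi> = (\<lambda>z. \<phi> z + c * norm (z - y))"
  have contg: "continuous_on A g" for A
    using deriv by (meson continuous_at_imp_continuous_on has_derivative_continuous)
  have cont: "continuous_on A \<psi>" for A
    unfolding \<psi>_def \<phi>_def by (intro continuous_intros contg)
  have \<phi>0: "\<phi> z \<ge> 0" for z unfolding \<phi>_def using le[of z] by simp
  \<comment> \<open>Outside the ball of radius \<open>R\<close> the penalty alone exceeds
    \<open>\<psi> y = \<phi> y\<close>, so a minimizer over this compact ball is a global minimizer
    of \<open>\<psi>\<close>.\<close>
  define R where "R = \<phi> y / c"
  have "R \<ge> 0" unfolding R_def using \<phi>0 c by simp
  then obtain z where z: "z \<in> cball y R" and zmin: "\<And>w. w \<in> cball y R \<Longrightarrow> \<psi> z \<le> \<psi> w"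
    using continuous_attains_inf[OF compact_cball[of y R] _ cont] by (metis centre_in_cball empty_iff)
  have zy: "\<psi> z \<le> \<phi> y"
    using zmin[of y] \<open>R \<ge> 0\<close> by (simp add: \<psi>_def)
  have gmin: "\<psi> z \<le> \<psi> w" for w
  proof (cases "w \<in> cball y R")
    case False
    then have "\<phi> y < c * norm (w - y)"
      using c by (simp add: R_def dist_norm norm_minus_commute field_simps)
    then show ?thesis using zy \<phi>0[of w] by (simp add: \<psi>_def)
  qed (rule zmin)
  have "g z = m"
  proof (rule ccontr)
    assume "g z \<noteq> m"
    with le[of z] have lt: "m - g z > 0" by (simp add: less_le)
    then have pz: "\<phi> z > 0" by (simp add: \<phi>_def)
    define w where "w = z + D z"
    have "(\<phi> has_derivative (\<lambda>h. - (D z \<bullet> h) * (inverse (\<phi> z) / 2))) (at z)"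
      unfolding \<phi>_def using lt by (auto intro!: derivative_eq_intros deriv)
    then have "(\<phi> has_derivative (\<lambda>h. (- (inverse (\<phi> z) / 2)) *\<^sub>R D z \<bullet> h)) (at z within UNIV)"
      by (simp add: mult.commute)
    from has_derivative_segment_quotient[OF this convex_UNIV UNIV_I UNIV_I, of w]
    have lim: "((\<lambda>s. (\<phi> (z + s *\<^sub>R D z) - \<phi> z) / s) \<longlongrightarrow> - (inverse (\<phi> z) / 2) * (norm (D z))\<^sup>2) (at_right 0)"
      by (simp add: w_def power2_norm_eq_inner)
    \<comment> \<open>Along the gradient \<open>D z\<close> the penalty grows at rate at most
      \<open>c * norm (D z)\<close>, so minimality of \<open>\<psi>\<close> lets
      \<open>\<phi>\<close> fall no faster. Its actual rate of decrease is
      \<open>(norm (D z))^2 / (2 * \<phi> z)\<close>, which gives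
      \<open>norm (D z) \<le> 2 * c * \<phi> z\<close> and contradicts the PL inequality.\<close>
    have "eventually (\<lambda>s. - c * norm (D z) \<le> (\<phi> (z + s *\<^sub>R D z) - \<phi> z) / s) (at_right (0::real))"
    proof (rule eventually_at_rightI[of 0 1])
      fix s :: real assume s: "s \<in> {0<..<1}"
      have "norm (z + s *\<^sub>R D z - y) \<le> norm (z - y) + s * norm (D z)"
        using norm_triangle_ineq[of "z - y" "s *\<^sub>R D z"] s by (simp add: algebra_simps)
      then have "c * norm (z + s *\<^sub>R D z - y) \<le> c * (norm (z - y) + s * norm (D z))"
        using c by simp
      then have "- c * norm (D z) * s \<le> \<phi> (z + s *\<^sub>R D z) - \<phi> z"
        using gmin[of "z + s *\<^sub>R D z"] by (simp add: \<psi>_def algebra_simps)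
      then show "- c * norm (D z) \<le> (\<phi> (z + s *\<^sub>R D z) - \<phi> z) / s"
        using s by (simp add: pos_le_divide_eq)
    qed simp
    then have "- c * norm (D z) \<le> - (inverse (\<phi> z) / 2) * (norm (D z))\<^sup>2"
      by (rule tendsto_lowerbound[OF lim]) simp
    then have "(norm (D z))\<^sup>2 \<le> 2 * c * \<phi> z * norm (D z)"
      using pz by (simp add: field_simps)
    moreover have Dpos: "norm (D z) > 0"
    proof -
      have "\<mu> > 0" using c by (smt (verit) zero_le_power2 field_sum_of_halves)
      then have "2 * \<mu> * (m - g z) > 0" using lt by simp
      then show ?thesis using PL[of z] by (smt (verit) zero_less_power2 norm_ge_zero)
    qed
    ultimately have "norm (D z) \<le> 2 * c * \<phi> z"
      by (simp add: power2_eq_square)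
    then have "(norm (D z))\<^sup>2 \<le> (2 * c * \<phi> z)\<^sup>2"
      by (rule power_mono) simp
    also have "\<dots> = 4 * c\<^sup>2 * (m - g z)"
      using lt by (simp add: power_mult_distrib \<phi>_def)
    also have "\<dots> < 2 * \<mu> * (m - g z)"
      using c lt by (intro mult_strict_right_mono) auto
    finally show False using PL[of z] by simp
  qed
  moreover have "c * norm (z - y) \<le> \<phi> y"
    using zy \<phi>0[of z] by (simp add: \<psi>_def)
  ultimately show ?thesis by (auto simp: \<phi>_def)
qed

text \<open>Let \<open>c\<close> increase to \<open>sqrt (\<mu> / 2)\<close>. The maximizer supplied
  for each \<open>c\<close> depends on \<open>c\<close>; replacing it by the closest one, which is
  no farther from \<open>y\<close>, leaves a fixed inequality in which the limit can be
  taken.\<close>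

lemma PL_quadratic_growth:
  fixes g :: "'a::euclidean_space \<Rightarrow> real"
  assumes deriv: "\<And>z. (g has_derivative (\<lambda>h. D z \<bullet> h)) (at z)"
    and le: "\<And>z. g z \<le> m"
    and PL: "\<And>z. (norm (D z))\<^sup>2 \<ge> 2 * \<mu> * (m - g z)"
    and "0 < \<mu>" and S: "closed {z. g z = m}"
  shows "m - g y \<ge> \<mu> / 2 * (norm (y - closest_point {z. g z = m} y))\<^sup>2"
proof -
  let ?d = "norm (y - closest_point {z. g z = m} y)"
  have *: "c * ?d \<le> sqrt (m - g y)" if c: "0 < c" "c < sqrt (\<mu> / 2)" for c
  proof -
    have "c\<^sup>2 < \<mu> / 2"
      using c \<open>0 < \<mu>\<close> by (metis less_eq_real_def real_less_rsqrt real_sqrt_less_iff real_sqrt_pow2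
          half_gt_zero power_strict_mono zero_less_numeral)
    from PL_maximizer_near[OF deriv le PL c(1) this]
    obtain z where z: "g z = m" "c * norm (z - y) \<le> sqrt (m - g y)" by blast
    have "?d \<le> norm (z - y)"
      using closest_point_le[OF S, of z y] z by (simp add: dist_norm norm_minus_commute)
    then show ?thesis using z c by (meson mult_left_mono order_trans less_imp_le)
  qed
  have "sqrt (\<mu> / 2) * ?d \<le> sqrt (m - g y)"
  proof (rule tendsto_le[OF _ tendsto_const])
    show "((\<lambda>c. c * ?d) \<longlongrightarrow> sqrt (\<mu> / 2) * ?d) (at_left (sqrt (\<mu> / 2)))"
      by (intro tendsto_intros)
    show "eventually (\<lambda>c. c * ?d \<le> sqrt (m - g y)) (at_left (sqrt (\<mu> / 2)))"
      using \<open>0 < \<mu>\<close> by (intro eventually_at_leftI[of 0]) (auto intro: *)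
  qed (simp add: trivial_limit_at_left_real)
  then have "(sqrt (\<mu> / 2) * ?d)\<^sup>2 \<le> (sqrt (m - g y))\<^sup>2"
    using \<open>0 < \<mu>\<close> by (intro power_mono) auto
  then show ?thesis using \<open>0 < \<mu>\<close> le[of y] by (simp add: power_mult_distrib)
qed

subsection \<open>Maximizers as a function of the primal variable\<close>

lemma real_le_of_square_le:
  fixes r a b :: real
  assumes "r\<^sup>2 \<le> a * r + b" "0 \<le> a" "0 \<le> b" "0 \<le> r"
  shows "r \<le> a + sqrt b"
proof (rule ccontr)
  assume "\<not> ?thesis"
  then have h: "a + sqrt b < r" "sqrt b < r" "sqrt b \<ge> 0" using assms by auto
  then have "a < r" by linarith
  have "b < (r - a) * r"
  proof -
    have "b = sqrt b * sqrt b" using assms by simp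
    also have "\<dots> \<le> (r - a) * sqrt b" using h by (intro mult_right_mono) auto
    also have "\<dots> < (r - a) * r" using h \<open>a < r\<close> by (intro mult_strict_left_mono) auto
    finally show ?thesis .
  qed
  then show False using assms(1) by (simp add: power2_eq_square algebra_simps)
qed

section \<open>Geometry of the maximizer sets\<close>

locale minimax_problem =
  fixes f :: "real^'d \<Rightarrow> real^'e \<Rightarrow> real"
    and grad_x :: "real^'d \<Rightarrow> real^'e \<Rightarrow> real^'d"
    and grad_y :: "real^'d \<Rightarrow> real^'e \<Rightarrow> real^'e"
    and grad_F :: "real^'d \<Rightarrow> real^'d"
    and Y :: "(real^'e) set"
    and L\<^sub>F L\<^sub>f \<mu> :: real
  assumes primal_GDERIV: "\<And>x. GDERIV (primal_function f Y) x :> grad_F x"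
    and grad_F_lipschitz_on: "L\<^sub>F-lipschitz_on UNIV grad_F"
    and gradient: "has_gradient_on f grad_x grad_y Y"
    and grad_lipschitz: "L\<^sub>f-lipschitz_on (UNIV \<times> Y) (\<lambda>z. (grad_x (fst z) (snd z), grad_y (fst z) (snd z)))"
    and mu_pos: "0 < \<mu>"
    and dual_assumption:
      "(closed Y \<and> convex Y \<and> (\<forall>x. strongly_concave_on \<mu> Y (f x))) \<or>
       (Y = UNIV \<and> (\<forall>x. concave_on UNIV (f x) \<and> dual_PL \<mu> f grad_y x))"
    and ex_maximizer: "\<And>x. \<exists>p. is_arg_max (f x) (\<lambda>y. y \<in> Y) p"
begin

definition maximizers :: "real^'d \<Rightarrow> (real^'e) set" where
  "maximizers x = {p. is_arg_max (f x) (\<lambda>y. y \<in> Y) p}"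

text \<open>Under strong concavity this is the unique maximizer, whatever \<open>y\<close> is. In
  the PL case it is a selection that follows the dual variable, and since it is the closest choice,
  changing the selection can never increase the dual error.\<close>

definition ystar :: "real^'d \<Rightarrow> real^'e \<Rightarrow> real^'e" where
  "ystar x y = closest_point (maximizers x) y"

lemma closed_Y: "closed Y" and convex_Y: "convex Y"
  using dual_assumption by auto

lemma L_nonneg: "0 \<le> L\<^sub>f"
  using grad_lipschitz lipschitz_on_nonneg by blast

lemma deriv_y:
  assumes "y \<in> Y"
  shows "(f x has_derivative (\<lambda>k. grad_y x y \<bullet> k)) (at y within Y)"
proof -
  have "((\<lambda>y. (\<lambda>z. f (fst z) (snd z)) (x, y)) has_derivative
      (\<lambda>k. (\<lambda>h. grad_x x y \<bullet> fst h + grad_y x y \<bullet> snd h) (0, k))) (at y within Y)"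
  proof (rule has_derivative_in_compose[where g' = "\<lambda>h. grad_x x y \<bullet> fst h + grad_y x y \<bullet> snd h"])
    show "((\<lambda>z. f (fst z) (snd z)) has_derivative (\<lambda>h. grad_x x y \<bullet> fst h + grad_y x y \<bullet> snd h))
        (at (x, y) within Pair x ` Y)"
      using gradient assms unfolding has_gradient_on_def by (blast intro: has_derivative_subset)
  qed (auto intro!: derivative_eq_intros)
  then show ?thesis by simp
qed

lemma deriv_x:
  assumes "y \<in> Y"
  shows "((\<lambda>x. f x y) has_derivative (\<lambda>k. grad_x x y \<bullet> k)) (at x)"
proof -
  have "((\<lambda>x. (\<lambda>z. f (fst z) (snd z)) (x, y)) has_derivative
      (\<lambda>k. (\<lambda>h. grad_x x y \<bullet> fst h + grad_y x y \<bullet> snd h) (k, 0))) (at x)"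
  proof (rule has_derivative_in_compose[where g' = "\<lambda>h. grad_x x y \<bullet> fst h + grad_y x y \<bullet> snd h"])
    show "((\<lambda>z. f (fst z) (snd z)) has_derivative (\<lambda>h. grad_x x y \<bullet> fst h + grad_y x y \<bullet> snd h))
        (at (x, y) within range (\<lambda>x. (x, y)))"
      using gradient assms unfolding has_gradient_on_def by (blast intro: has_derivative_subset)
  qed (auto intro!: derivative_eq_intros)
  then show ?thesis by simp
qed

text \<open>What both alternatives share: modulus 0 expresses concavity relative to \<open>Y\<close>
  in the form to which the upper model applies.\<close>

lemma strongly_concave_0: "strongly_concave_on 0 Y (f x)"
  using dual_assumption
proof
  assume "closed Y \<and> convex Y \<and> (\<forall>x. strongly_concave_on \<mu> Y (f x))"
  then have sc: "strongly_concave_on \<mu> Y (f x)" by simp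
  show ?thesis
    unfolding strongly_concave_on_def
  proof (intro conjI ballI)
    fix a b :: "real^'e" and s :: real
    assume "a \<in> Y" "b \<in> Y" "s \<in> {0..1}"
    moreover from this have "0 \<le> \<mu> / 2 * s * (1 - s) * (norm (a - b))\<^sup>2"
      using mu_pos by simp
    ultimately show "f x (s *\<^sub>R a + (1 - s) *\<^sub>R b) \<ge>
        s * f x a + (1 - s) * f x b + 0 / 2 * s * (1 - s) * (norm (a - b))\<^sup>2"
      using sc unfolding strongly_concave_on_def by force
  qed (rule convex_Y)
next
  assume *: "Y = UNIV \<and> (\<forall>x. concave_on UNIV (f x) \<and> dual_PL \<mu> f grad_y x)"
  then have "concave_on UNIV (f x)" by blast
  then show ?thesis using * unfolding strongly_concave_on_def concave_on_iff by auto
qed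

lemma mem_maximizers: "p \<in> maximizers x \<longleftrightarrow> p \<in> Y \<and> (\<forall>z\<in>Y. f x z \<le> f x p)"
  unfolding maximizers_def is_arg_max_def by (auto simp: not_less)

lemma maximizers_nonempty: "maximizers x \<noteq> {}"
  using ex_maximizer by (auto simp: maximizers_def)

lemma primal_eq:
  assumes "p \<in> maximizers x"
  shows "primal_function f Y x = f x p"
  unfolding primal_function_def
  by (rule cSup_eq_maximum) (use assms in \<open>auto simp: mem_maximizers\<close>)

lemma le_primal: "y \<in> Y \<Longrightarrow> f x y \<le> primal_function f Y x"
  using maximizers_nonempty[of x] primal_eq[of _ x] mem_maximizers[of _ x] by fastforce

lemma maximizers_eq: "maximizers x = {p \<in> Y. f x p = primal_function f Y x}"
  using primal_eq le_primal by (auto simp: mem_maximizers)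

lemma closed_maximizers: "closed (maximizers x)"
proof -
  have "continuous_on Y (f x)"
    using deriv_y has_derivative_continuous continuous_on_eq_continuous_within by blast
  then have "closed (Y \<inter> f x -` {primal_function f Y x})"
    using closed_Y by (intro continuous_closed_preimage) auto
  moreover have "Y \<inter> f x -` {primal_function f Y x} = maximizers x"
    by (auto simp: maximizers_eq)
  ultimately show ?thesis by simp
qed

lemma convex_maximizers: "convex (maximizers x)"
proof (rule convexI)
  fix a b and u v :: real
  assume ab: "a \<in> maximizers x" "b \<in> maximizers x" and uv: "0 \<le> u" "0 \<le> v" "u + v = 1"
  have v: "v = 1 - u" using uv by simp
  have Yab: "a \<in> Y" "b \<in> Y" using ab by (auto simp: maximizers_eq)
  have in_Y: "u *\<^sub>R a + v *\<^sub>R b \<in> Y" using convexD[OF convex_Y Yab uv] .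
  have "f x (u *\<^sub>R a + v *\<^sub>R b) \<ge> u * f x a + v * f x b"
    using strongly_concave_0[of x] Yab uv unfolding strongly_concave_on_def v by auto
  also have "u * f x a + v * f x b = primal_function f Y x"
    using ab uv by (simp add: maximizers_eq flip: distrib_right)
  finally show "u *\<^sub>R a + v *\<^sub>R b \<in> maximizers x"
    using in_Y le_primal[OF in_Y, of x] by (simp add: maximizers_eq)
qed

lemma ystar_maximizer: "ystar x y \<in> maximizers x"
  unfolding ystar_def by (rule closest_point_in_set[OF closed_maximizers maximizers_nonempty])

lemma ystar_in_Y: "ystar x y \<in> Y"
  using ystar_maximizer by (simp add: mem_maximizers)

lemma ystar_le: "p \<in> maximizers x \<Longrightarrow> norm (y - ystar x y) \<le> norm (y - p)"
  using closest_point_le[OF closed_maximizers] by (simp add: ystar_def dist_norm)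

lemma maximizer_VI: "p \<in> maximizers x \<Longrightarrow> z \<in> Y \<Longrightarrow> grad_y x p \<bullet> (z - p) \<le> 0"
  by (rule maximizer_variational_inequality[OF _ convex_Y deriv_y]) (auto simp: mem_maximizers)

text \<open>By the variational inequality \<open>grad_y x p\<close> lies in the normal cone of
  \<open>Y\<close> at \<open>p\<close>, so projection undoes the step. On the boundary this gradient
  may be nonzero; as a fixed point, \<open>p\<close> can still be compared with a projected ascent
  step through nonexpansiveness, with only the difference of the two gradients appearing.\<close>

lemma maximizer_fixpoint:
  assumes p: "p \<in> maximizers x" and "0 \<le> \<eta>"
  shows "closest_point Y (p + \<eta> *\<^sub>R grad_y x p) = p"
proof (rule closest_point_unique[OF convex_Y closed_Y, symmetric])
  show "p \<in> Y" using p by (simp add: mem_maximizers)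
  show "\<forall>z\<in>Y. dist (p + \<eta> *\<^sub>R grad_y x p) p \<le> dist (p + \<eta> *\<^sub>R grad_y x p) z"
  proof
    fix z assume "z \<in> Y"
    let ?g = "\<eta> *\<^sub>R grad_y x p"
    have "?g \<bullet> (z - p) \<le> 0"
      using maximizer_VI[OF p \<open>z \<in> Y\<close>] \<open>0 \<le> \<eta>\<close> by (simp add: mult_nonneg_nonpos)
    then have "(norm ?g)\<^sup>2 \<le> (norm (?g - (z - p)))\<^sup>2"
      using zero_le_power2[of "norm (z - p)"] unfolding power2_norm_eq_inner
      by (simp add: inner_diff_left inner_diff_right inner_commute)
    then have "norm ?g \<le> norm (?g - (z - p))" using power2_le_imp_le norm_ge_zero by blast
    moreover have "?g - (z - p) = p + ?g - z" by simp
    ultimately show "dist (p + ?g) p \<le> dist (p + ?g) z" by (simp add: dist_norm)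
  qed
qed

lemma grad_lipschitz_dist:
  assumes "y \<in> Y" "y' \<in> Y"
  shows "norm (grad_x x y - grad_x x' y') \<le> L\<^sub>f * norm ((x, y) - (x', y'))"
    and "norm (grad_y x y - grad_y x' y') \<le> L\<^sub>f * norm ((x, y) - (x', y'))"
proof -
  have *: "norm (grad_x x y - grad_x x' y', grad_y x y - grad_y x' y') \<le> L\<^sub>f * norm ((x, y) - (x', y'))"
    using lipschitz_on_normD[OF grad_lipschitz, of "(x, y)" "(x', y')"] assms by simp
  show "norm (grad_x x y - grad_x x' y') \<le> L\<^sub>f * norm ((x, y) - (x', y'))"
    "norm (grad_y x y - grad_y x' y') \<le> L\<^sub>f * norm ((x, y) - (x', y'))"
    using * norm_fst_le[of "grad_x x y - grad_x x' y'" "grad_y x y - grad_y x' y'"]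
      norm_snd_le[of "grad_y x y - grad_y x' y'" "grad_x x y - grad_x x' y'"] by linarith+
qed

text \<open>The factor \<open>1/2\<close> is lost only in the PL case; using it in both cases lets one argument serve
  both alternatives.\<close>

lemma grad_y_monotone:
  assumes "y \<in> Y"
  shows "(grad_y x y - grad_y x (ystar x y)) \<bullet> (y - ystar x y) \<le> - (\<mu> / 2) * (norm (y - ystar x y))\<^sup>2"
  using dual_assumption
proof
  assume "closed Y \<and> convex Y \<and> (\<forall>x. strongly_concave_on \<mu> Y (f x))"
  then have sc: "strongly_concave_on \<mu> Y (f x)" by simp
  let ?p = "ystar x y"
  note upper = strongly_concave_on_upper_model[OF sc deriv_y]
  have "f x ?p \<le> f x y + grad_y x y \<bullet> (?p - y) - \<mu> / 2 * (norm (?p - y))\<^sup>2"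
    by (rule upper) (use assms ystar_in_Y in auto)
  moreover have "f x y \<le> f x ?p + grad_y x ?p \<bullet> (y - ?p) - \<mu> / 2 * (norm (y - ?p))\<^sup>2"
    by (rule upper) (use assms ystar_in_Y in auto)
  ultimately have "0 \<le> (grad_y x y - grad_y x ?p) \<bullet> (?p - y) - \<mu> * (norm (y - ?p))\<^sup>2"
    by (simp add: inner_diff_left inner_diff_right norm_minus_commute)
  moreover have "0 \<le> \<mu> * (norm (y - ?p))\<^sup>2" using mu_pos by simp
  ultimately show ?thesis by (simp add: inner_diff_left inner_diff_right)
next
  assume *: "Y = UNIV \<and> (\<forall>x. concave_on UNIV (f x) \<and> dual_PL \<mu> f grad_y x)"
  let ?p = "ystar x y" and ?m = "primal_function f Y x"
  \<comment> \<open>Every point is feasible here, so the variational inequality may be tested in the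
    direction of the gradient itself, which forces the gradient to vanish.\<close>
  have "grad_y x ?p \<bullet> (?p + grad_y x ?p - ?p) \<le> 0"
    by (rule maximizer_VI[OF ystar_maximizer]) (use * in simp)
  then have gp: "grad_y x ?p = 0"
    by (metis add_diff_cancel_left' inner_eq_zero_iff inner_ge_zero order_antisym)
  have Y: "z \<in> Y" for z using * by simp
  have set_eq: "maximizers x = {z. f x z = ?m}" using Y by (auto simp: maximizers_eq)
  have "?m - f x y \<ge> \<mu> / 2 * (norm (y - closest_point {z. f x z = ?m} y))\<^sup>2"
  proof (rule PL_quadratic_growth)
    show "(f x has_derivative (\<lambda>h. grad_y x z \<bullet> h)) (at z)" for z
      using deriv_y[of z x] * by simp
    show "(norm (grad_y x z))\<^sup>2 \<ge> 2 * \<mu> * (?m - f x z)" for z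
      using * by (auto simp: dual_PL_def)
    show "f x z \<le> ?m" for z by (rule le_primal[OF Y])
    show "closed {z. f x z = ?m}" using closed_maximizers[of x] by (simp add: set_eq)
  qed (rule mu_pos)
  then have "?m - f x y \<ge> \<mu> / 2 * (norm (y - ?p))\<^sup>2"
    by (simp add: ystar_def set_eq)
  moreover have "f x ?p = ?m" using primal_eq[OF ystar_maximizer] by simp
  \<comment> \<open>Concavity bounds the inner product by the negative gap in function values, and
    quadratic growth bounds that gap from below by \<open>\<mu> / 2\<close> times the squared
    distance.\<close>
  moreover have "f x ?p \<le> f x y + grad_y x y \<bullet> (?p - y)"
    using strongly_concave_on_upper_model[OF strongly_concave_0 deriv_y[OF assms, of x] assms ystar_in_Y] by simp
  ultimately show ?thesis by (simp add: gp inner_diff_right)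
qed

text \<open>Monotonicity for \<open>x'\<close> controls the squared distance from \<open>p\<close>
  to its closest maximizer \<open>q\<close>. The variational inequalities of \<open>p\<close> for
  \<open>x\<close> and of \<open>q\<close> for \<open>x'\<close> then leave only the change of
  \<open>grad_y\<close> in \<open>x\<close> at the fixed point \<open>p\<close>. The factor 2 comes
  from the modulus \<open>\<mu> / 2\<close>. Exchanging \<open>x\<close> and \<open>x'\<close> gives
  the Hausdorff estimate.\<close>

lemma maximizers_lipschitz:
  assumes p: "p \<in> maximizers x"
  shows "norm (p - ystar x' p) \<le> 2 * (L\<^sub>f / \<mu>) * norm (x' - x)"
proof -
  let ?q = "ystar x' p" and ?r = "norm (p - ystar x' p)"
  have Yp: "p \<in> Y" using p by (simp add: mem_maximizers)
  have "\<mu> / 2 * ?r\<^sup>2 \<le> (grad_y x' p - grad_y x' ?q) \<bullet> (?q - p)"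
    using grad_y_monotone[OF Yp, of x'] by (simp add: inner_diff_left inner_diff_right)
  also have "\<dots> \<le> (grad_y x' p - grad_y x p) \<bullet> (?q - p)"
    using maximizer_VI[OF p ystar_in_Y, of x' p] maximizer_VI[OF ystar_maximizer Yp, of x' p]
    by (simp add: inner_diff_left inner_diff_right)
  also have "\<dots> \<le> norm (grad_y x' p - grad_y x p) * norm (?q - p)"
    by (rule norm_cauchy_schwarz)
  also have "\<dots> \<le> (L\<^sub>f * norm (x' - x)) * ?r"
    using grad_lipschitz_dist(2)[OF Yp Yp, of x' x]
    by (auto simp: norm_minus_commute norm_Pair intro!: mult_right_mono)
  finally have *: "\<mu> / 2 * ?r\<^sup>2 \<le> (L\<^sub>f * norm (x' - x)) * ?r" .
  show ?thesis
  proof (cases "?r = 0")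
    case True
    then show ?thesis using L_nonneg mu_pos by simp
  next
    case False
    then have "\<mu> / 2 * ?r \<le> L\<^sub>f * norm (x' - x)"
      using * by (simp add: power2_eq_square)
    then show ?thesis using mu_pos by (simp add: field_simps)
  qed
qed

text \<open>The closest maximizer for \<open>x'\<close> competes with the one nearest to
  \<open>ystar x y\<close>. As \<open>y\<close> and \<open>y'\<close> are unrelated, the old
  maximizer can serve as reference for the new dual iterate.\<close>

lemma ystar_drift:
  "norm (y' - ystar x' y') \<le> norm (y' - ystar x y) + 2 * (L\<^sub>f / \<mu>) * norm (x' - x)"
proof -
  have "norm (y' - ystar x' y') \<le> norm (y' - ystar x' (ystar x y))"
    by (rule ystar_le[OF ystar_maximizer])
  also have "\<dots> \<le> norm (y' - ystar x y) + norm (ystar x y - ystar x' (ystar x y))"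
    using norm_triangle_ineq[of "y' - ystar x y" "ystar x y - ystar x' (ystar x y)"] by simp
  also have "\<dots> \<le> norm (y' - ystar x y) + 2 * (L\<^sub>f / \<mu>) * norm (x' - x)"
    using maximizers_lipschitz[OF ystar_maximizer] by simp
  finally show ?thesis .
qed

lemma ystar_dot: "q \<in> maximizers x \<Longrightarrow> (y - ystar x y) \<bullet> (q - ystar x y) \<le> 0"
  unfolding ystar_def by (rule closest_point_dot[OF convex_maximizers closed_maximizers])

text \<open>The resulting continuity makes the closest maximizer a measurable selection along the run. The
  square root is the price of projecting onto sets that are merely Hausdorff-close.\<close>

lemma ystar_modulus:
  defines "c \<equiv> 2 * (L\<^sub>f / \<mu>)"
  shows "norm (ystar x y - ystar x' y') \<le> norm (y - y') +
    sqrt (c * norm (x' - x) * (2 * norm (y - ystar x y) + norm (y - y') + c * norm (x' - x)))"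
proof -
  define p p' where "p = ystar x y" and "p' = ystar x' y'"
  define e where "e = c * norm (x' - x)"
  have c0: "c \<ge> 0" using L_nonneg mu_pos by (simp add: c_def)
  then have e0: "e \<ge> 0" by (simp add: e_def)
  \<comment> \<open>\<open>p\<close> and \<open>p'\<close> belong to different sets, so the angle
    condition of one projection cannot be tested at the other point. \<open>q\<close> and
    \<open>q'\<close> are substitutes in the right sets, within distance \<open>e\<close>.\<close>
  define q q' where "q = ystar x p'" and "q' = ystar x' p"
  have pm: "p \<in> maximizers x" "p' \<in> maximizers x'"
    by (simp_all add: p_def p'_def ystar_maximizer)
  have q: "q \<in> maximizers x" "norm (p' - q) \<le> e"
    using maximizers_lipschitz[OF pm(2), of x]
    by (simp_all add: q_def e_def c_def ystar_maximizer norm_minus_commute)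
  have q': "q' \<in> maximizers x'" "norm (p - q') \<le> e"
    using maximizers_lipschitz[OF pm(1), of x']
    by (simp_all add: q'_def e_def c_def ystar_maximizer)
  have dist': "norm (y' - p') \<le> norm (y - y') + norm (y - p) + e"
  proof -
    have "norm (y' - p') \<le> norm (y' - p) + e"
      using ystar_drift[of y' x' x y] by (simp add: p_def p'_def e_def c_def)
    moreover have "norm (y' - p) \<le> norm (y - y') + norm (y - p)"
      using norm_triangle_ineq[of "y' - y" "y - p"] by (simp add: norm_minus_commute)
    ultimately show ?thesis by simp
  qed
  have A: "(y - p) \<bullet> (p' - p) \<le> norm (y - p) * e"
  proof -
    have "(y - p) \<bullet> (p' - p) = (y - p) \<bullet> (p' - q) + (y - p) \<bullet> (q - p)"
      by (simp add: inner_diff_right)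
    also have "\<dots> \<le> norm (y - p) * norm (p' - q) + 0"
      using ystar_dot[OF q(1), of y] norm_cauchy_schwarz[of "y - p" "p' - q"] by (simp add: p_def)
    finally show ?thesis using q(2) by (smt (verit) mult_left_mono norm_ge_zero)
  qed
  have B: "(y' - p') \<bullet> (p - p') \<le> norm (y' - p') * e"
  proof -
    have "(y' - p') \<bullet> (p - p') = (y' - p') \<bullet> (p - q') + (y' - p') \<bullet> (q' - p')"
      by (simp add: inner_diff_right)
    also have "\<dots> \<le> norm (y' - p') * norm (p - q') + 0"
      using ystar_dot[OF q'(1), of y'] norm_cauchy_schwarz[of "y' - p'" "p - q'"] by (simp add: p'_def)
    finally show ?thesis using q'(2) by (smt (verit) mult_left_mono norm_ge_zero)
  qed
  \<comment> \<open>The substitutes contribute to the squared distance a term of first order in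
    \<open>e\<close>, which is where the square root originates.\<close>
  have "(norm (p - p'))\<^sup>2 = (y - p) \<bullet> (p' - p) + (y' - p') \<bullet> (p - p') + (y - y') \<bullet> (p - p')"
    by (simp add: power2_norm_eq_inner inner_diff_left inner_diff_right inner_commute)
  also have "\<dots> \<le> norm (y - p) * e + norm (y' - p') * e + norm (y - y') * norm (p - p')"
    using A B norm_cauchy_schwarz[of "y - y'" "p - p'"] by simp
  also have "\<dots> \<le> norm (y - y') * norm (p - p') + e * (2 * norm (y - p) + norm (y - y') + e)"
    using mult_right_mono[OF dist' e0] by (simp add: algebra_simps)
  finally have "norm (p - p') \<le> norm (y - y') + sqrt (e * (2 * norm (y - p) + norm (y - y') + e))"
    using e0 by (intro real_le_of_square_le) auto
  then show ?thesis by (simp add: p_def p'_def e_def)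
qed

lemma continuous_ystar: "continuous_on UNIV (\<lambda>z. ystar (fst z) (snd z))"
proof (clarsimp simp: continuous_on_def)
  fix x y
  let ?c = "2 * (L\<^sub>f / \<mu>)"
  let ?b = "\<lambda>z. norm (y - snd z) + sqrt (?c * norm (fst z - x) *
      (2 * norm (y - ystar x y) + norm (y - snd z) + ?c * norm (fst z - x)))"
  have "(?b \<longlongrightarrow> norm (y - snd (x, y)) + sqrt (?c * norm (fst (x, y) - x) *
      (2 * norm (y - ystar x y) + norm (y - snd (x, y)) + ?c * norm (fst (x, y) - x)))) (at (x, y))"
    by (intro tendsto_intros)
  then have b: "(?b \<longlongrightarrow> 0) (at (x, y))" by simp
  have "((\<lambda>z. norm (ystar (fst z) (snd z) - ystar x y)) \<longlongrightarrow> 0) (at (x, y))"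
    by (rule tendsto_sandwich[OF _ _ tendsto_const b])
      (use ystar_modulus[of x y] in \<open>auto simp: norm_minus_commute intro!: always_eventually\<close>)
  then show "((\<lambda>z. ystar (fst z) (snd z)) \<longlongrightarrow> ystar x y) (at (x, y))"
    by (simp add: tendsto_norm_zero_iff LIM_zero_iff)
qed

section \<open>The gradient of the primal function\<close>

text \<open>Envelope argument: the primal function lies above \<open>\<lambda>z. f z p\<close> and
  meets it at \<open>x\<close>, so their difference has a minimum there and zero derivative. In
  particular \<open>grad_x x\<close> takes the same value at all maximizers.\<close>

lemma grad_F_eq:
  assumes "p \<in> maximizers x"
  shows "grad_F x = grad_x x p"
proof -
  have Yp: "p \<in> Y" using assms by (simp add: mem_maximizers)
  have "((\<lambda>z. primal_function f Y z - f z p) has_derivative (\<lambda>h. h \<bullet> grad_F x - grad_x x p \<bullet> h)) (at x)"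
    using primal_GDERIV[of x] deriv_x[OF Yp, of x] unfolding gderiv_def by (rule has_derivative_diff)
  then have "(\<lambda>h. h \<bullet> grad_F x - grad_x x p \<bullet> h) = (\<lambda>h. 0)"
    by (rule has_derivative_local_min)
      (use le_primal[OF Yp] primal_eq[OF assms] in \<open>auto intro!: always_eventually\<close>)
  \<comment> \<open>The vanishing derivative is evaluated at \<open>grad_F x - grad_x x p\<close>,
    which turns it into the square of the norm of that vector.\<close>
  then have "(grad_F x - grad_x x p) \<bullet> grad_F x - grad_x x p \<bullet> (grad_F x - grad_x x p) = 0"
    by metis
  then have "(grad_F x - grad_x x p) \<bullet> (grad_F x - grad_x x p) = 0"
    by (simp add: inner_diff_left inner_diff_right inner_commute)
  then show ?thesis by simp
qed

text \<open>A Lipschitz constant in terms of \<open>L\<^sub>f\<close> and \<open>\<mu>\<close>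
  alone, from the envelope formula and the Lipschitz dependence of the maximizers. The momentum
  drift uses it in place of \<open>L\<^sub>F\<close>, so that \<open>L\<^sub>F\<close> stays out of
  the final rate.\<close>

lemma grad_F_lipschitz:
  "norm (grad_F x - grad_F x') \<le> L\<^sub>f * (1 + 2 * (L\<^sub>f / \<mu>)) * norm (x - x')"
proof -
  \<comment> \<open>The argument 0 is arbitrary; any maximizer for \<open>x\<close> would
    do.\<close>
  define p where "p = ystar x 0"
  have p: "p \<in> maximizers x" by (simp add: p_def ystar_maximizer)
  then have Yp: "p \<in> Y" by (simp add: mem_maximizers)
  have "norm (grad_F x - grad_F x') = norm (grad_x x p - grad_x x' (ystar x' p))"
    using grad_F_eq[OF p] grad_F_eq[OF ystar_maximizer] by metis
  also have "\<dots> \<le> L\<^sub>f * norm ((x, p) - (x', ystar x' p))"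
    by (rule grad_lipschitz_dist(1)[OF Yp ystar_in_Y])
  also have "\<dots> \<le> L\<^sub>f * (norm (x - x') + norm (p - ystar x' p))"
    using L_nonneg norm_Pair_le[of "x - x'" "p - ystar x' p"] by (intro mult_left_mono) auto
  also have "\<dots> \<le> L\<^sub>f * (norm (x - x') + 2 * (L\<^sub>f / \<mu>) * norm (x - x'))"
    using maximizers_lipschitz[OF p, of x'] L_nonneg by (intro mult_left_mono add_left_mono) (auto simp: norm_minus_commute)
  finally show ?thesis by (simp add: algebra_simps)
qed

lemma grad_x_error:
  assumes "y \<in> Y"
  shows "norm (grad_x x y - grad_F x) \<le> L\<^sub>f * norm (y - ystar x y)"
  using grad_lipschitz_dist(1)[OF assms ystar_in_Y, of x x x y]
  by (simp add: grad_F_eq[OF ystar_maximizer[of x y]] norm_Pair)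

text \<open>The mean value theorem on the segment gives the coefficient \<open>L\<^sub>F\<close>;
  integrating the gradient would give half of it.\<close>

lemma primal_descent:
  "primal_function f Y (x + h) \<le> primal_function f Y x + grad_F x \<bullet> h + L\<^sub>F * (norm h)\<^sup>2"
proof -
  let ?\<phi> = "\<lambda>s. primal_function f Y (x + s *\<^sub>R h)"
  have "DERIV ?\<phi> s :> grad_F (x + s *\<^sub>R h) \<bullet> h" for s
  proof -
    have "(?\<phi> has_derivative (\<lambda>k. (k *\<^sub>R h) \<bullet> grad_F (x + s *\<^sub>R h))) (at s)"
      by (rule has_derivative_compose[where g' = "\<lambda>k. k \<bullet> grad_F (x + s *\<^sub>R h)"])
        (use primal_GDERIV in \<open>auto simp: gderiv_def intro!: derivative_eq_intros\<close>)
    then show ?thesis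
      by (simp add: has_field_derivative_def mult_commute_abs inner_commute)
  qed
  then obtain s where s: "0 < s" "s < 1" "?\<phi> 1 - ?\<phi> 0 = (1 - 0) * (grad_F (x + s *\<^sub>R h) \<bullet> h)"
    using MVT2[of 0 1 ?\<phi> "\<lambda>s. grad_F (x + s *\<^sub>R h) \<bullet> h"] by auto
  have "(grad_F (x + s *\<^sub>R h) - grad_F x) \<bullet> h \<le> norm (grad_F (x + s *\<^sub>R h) - grad_F x) * norm h"
    by (rule norm_cauchy_schwarz)
  also have "\<dots> \<le> (L\<^sub>F * norm (s *\<^sub>R h)) * norm h"
    using lipschitz_on_normD[OF grad_F_lipschitz_on, of "x + s *\<^sub>R h" x] by (intro mult_right_mono) auto
  also have "\<dots> \<le> (L\<^sub>F * norm h) * norm h"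
    using s lipschitz_on_nonneg[OF grad_F_lipschitz_on]
    by (intro mult_right_mono mult_left_mono) (auto intro: mult_left_le_one_le)
  finally show ?thesis using s(3) by (simp add: inner_diff_left power2_eq_square)
qed

end

subsection \<open>Square-integrable vectors and conditional noise\<close>

definition square_integrable :: "'w measure \<Rightarrow> ('w \<Rightarrow> 'a::euclidean_space) \<Rightarrow> bool" where
  "square_integrable M f \<longleftrightarrow> f \<in> borel_measurable M \<and> integrable M (\<lambda>\<omega>. (norm (f \<omega>))\<^sup>2)"

lemma square_integrableD:
  assumes "square_integrable M f"
  shows "f \<in> borel_measurable M" "integrable M (\<lambda>\<omega>. (norm (f \<omega>))\<^sup>2)"
  using assms by (auto simp: square_integrable_def)

lemma square_integrable_bound:
  assumes "square_integrable M g" "f \<in> borel_measurable M" "AE \<omega> in M. norm (f \<omega>) \<le> norm (g \<omega>)"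
  shows "square_integrable M f"
proof -
  have "integrable M (\<lambda>\<omega>. (norm (f \<omega>))\<^sup>2)"
  proof (rule Bochner_Integration.integrable_bound[OF square_integrableD(2)[OF assms(1)]])
    show "(\<lambda>\<omega>. (norm (f \<omega>))\<^sup>2) \<in> borel_measurable M" using assms(2) by measurable
    show "AE \<omega> in M. norm ((norm (f \<omega>))\<^sup>2) \<le> norm ((norm (g \<omega>))\<^sup>2)"
      using assms(3) by eventually_elim (simp add: power_mono)
  qed
  then show ?thesis using assms(2) by (simp add: square_integrable_def)
qed

lemma norm_add_square_le:
  fixes a b :: "'a::real_inner"
  shows "(norm (a + b))\<^sup>2 \<le> 2 * (norm a)\<^sup>2 + 2 * (norm b)\<^sup>2"
  using zero_le_power2[of "norm (a - b)"] unfolding power2_norm_eq_inner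
  by (simp add: inner_add_left inner_add_right inner_diff_left inner_diff_right inner_commute)

lemma square_integrable_add:
  assumes "square_integrable M f" "square_integrable M g"
  shows "square_integrable M (\<lambda>\<omega>. f \<omega> + g \<omega>)"
proof -
  note m[measurable] = square_integrableD(1)[OF assms(1)] square_integrableD(1)[OF assms(2)]
  have "integrable M (\<lambda>\<omega>. 2 * (norm (f \<omega>))\<^sup>2 + 2 * (norm (g \<omega>))\<^sup>2)"
    using assms by (auto simp: square_integrable_def)
  then have "integrable M (\<lambda>\<omega>. (norm (f \<omega> + g \<omega>))\<^sup>2)"
    by (rule Bochner_Integration.integrable_bound) (auto simp: norm_add_square_le)
  then show ?thesis by (simp add: square_integrable_def)
qed

lemma square_integrable_scaleR:
  "square_integrable M f \<Longrightarrow> square_integrable M (\<lambda>\<omega>. c *\<^sub>R f \<omega>)"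
  by (auto simp: square_integrable_def power_mult_distrib)

lemma square_integrable_diff:
  "square_integrable M f \<Longrightarrow> square_integrable M g \<Longrightarrow> square_integrable M (\<lambda>\<omega>. f \<omega> - g \<omega>)"
  using square_integrable_add[of M f "\<lambda>\<omega>. - 1 *\<^sub>R g \<omega>"] square_integrable_scaleR[of M g "-1"] by simp

lemma square_integrable_norm:
  "square_integrable M f \<Longrightarrow> square_integrable M (\<lambda>\<omega>. norm (f \<omega>))"
  by (auto simp: square_integrable_def)

lemma (in finite_measure) square_integrable_const: "square_integrable M (\<lambda>_. c)"
  by (simp add: square_integrable_def)

lemma square_integrable_cong:
  assumes "square_integrable M f" "\<And>\<omega>. \<omega> \<in> space M \<Longrightarrow> g \<omega> = f \<omega>"
  shows "square_integrable M g"
proof -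
  have "g \<in> borel_measurable M"
    using assms by (subst measurable_cong[of _ g f]) (auto simp: square_integrable_def)
  then show ?thesis by (rule square_integrable_bound[OF assms(1)]) (simp add: assms(2))
qed

lemma square_integrable_inner:
  assumes "square_integrable M f" "square_integrable M g"
  shows "integrable M (\<lambda>\<omega>. f \<omega> \<bullet> g \<omega>)"
proof -
  note m[measurable] = square_integrableD(1)[OF assms(1)] square_integrableD(1)[OF assms(2)]
  have "integrable M (\<lambda>\<omega>. (norm (f \<omega>))\<^sup>2 + (norm (g \<omega>))\<^sup>2)"
    using assms by (auto simp: square_integrable_def)
  then show ?thesis
  proof (rule Bochner_Integration.integrable_bound)
    show "AE \<omega> in M. norm (f \<omega> \<bullet> g \<omega>) \<le> norm ((norm (f \<omega>))\<^sup>2 + (norm (g \<omega>))\<^sup>2)"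
    proof (rule AE_I2)
      fix \<omega>
      have "\<bar>f \<omega> \<bullet> g \<omega>\<bar> \<le> norm (f \<omega>) * norm (g \<omega>)" by (rule Cauchy_Schwarz_ineq2)
      moreover have "2 * (norm (f \<omega>) * norm (g \<omega>)) \<le> (norm (f \<omega>))\<^sup>2 + (norm (g \<omega>))\<^sup>2"
        using sum_squares_bound[of "norm (f \<omega>)" "norm (g \<omega>)"] by simp
      moreover have "0 \<le> norm (f \<omega>) * norm (g \<omega>)" by simp
      ultimately show "norm (f \<omega> \<bullet> g \<omega>) \<le> norm ((norm (f \<omega>))\<^sup>2 + (norm (g \<omega>))\<^sup>2)"
        by simp
    qed
  qed measurable
qed

lemma borel_measurable_vecI:
  fixes f :: "'w \<Rightarrow> real^'n"
  assumes "\<And>i. (\<lambda>\<omega>. f \<omega> $ i) \<in> borel_measurable M"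
  shows "f \<in> borel_measurable M"
  by (subst borel_measurable_euclidean_space) (auto simp: Basis_vec_def inner_axis assms)

lemma borel_measurable_vec_nth [measurable]:
  fixes f :: "'w \<Rightarrow> real^'n"
  assumes [measurable]: "f \<in> borel_measurable M"
  shows "(\<lambda>\<omega>. f \<omega> $ i) \<in> borel_measurable M"
proof -
  have "(\<lambda>\<omega>. f \<omega> \<bullet> axis i 1) \<in> borel_measurable M" by measurable
  then show ?thesis by (simp add: inner_axis)
qed

lemma (in finite_measure) sigma_finite_subalgebraI:
  "subalgebra M N \<Longrightarrow> sigma_finite_subalgebra M N"
  by (intro finite_measure_subalgebra_is_sigma_finite finite_measure_subalgebra.intro
      finite_measure_subalgebra_axioms.intro finite_measure_axioms)

section \<open>Oracle noise: variance and orthogonality\<close>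

context prob_space
begin

text \<open>The conditional bound is integrated in the extended nonnegative reals, so finiteness of
  the second moment is a conclusion and need not be known beforehand.\<close>

lemma cond_unbiased_variance:
  fixes g m :: "'a \<Rightarrow> real^'n"
  assumes cu: "cond_unbiased M N \<sigma> g m" and N: "subalgebra M N"
    and m [measurable]: "m \<in> borel_measurable N"
  shows "square_integrable M (\<lambda>\<omega>. g \<omega> - m \<omega>)"
    and "(\<integral>\<omega>. (norm (g \<omega> - m \<omega>))\<^sup>2 \<partial>M) \<le> \<sigma>\<^sup>2"
proof -
  interpret sigma_finite_subalgebra M N using N by (rule sigma_finite_subalgebraI)
  have [measurable]: "m \<in> borel_measurable M" "g \<in> borel_measurable M"
    using measurable_from_subalg[OF N m] cu by (auto simp: cond_unbiased_def)
  have "(\<integral>\<^sup>+\<omega>. ennreal ((norm (g \<omega> - m \<omega>))\<^sup>2) \<partial>M)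
      = (\<integral>\<^sup>+\<omega>. 1 * nn_cond_exp M N (\<lambda>\<omega>. ennreal ((norm (g \<omega> - m \<omega>))\<^sup>2)) \<omega> \<partial>M)"
    by (subst nn_cond_exp_intg) auto
  also have "\<dots> \<le> (\<integral>\<^sup>+\<omega>. ennreal (\<sigma>\<^sup>2) \<partial>M)"
    using cu unfolding cond_unbiased_def by (intro nn_integral_mono_AE) auto
  also have "\<dots> = ennreal (\<sigma>\<^sup>2)" by (simp add: emeasure_space_1)
  finally have le: "(\<integral>\<^sup>+\<omega>. ennreal ((norm (g \<omega> - m \<omega>))\<^sup>2) \<partial>M) \<le> ennreal (\<sigma>\<^sup>2)" .
  have int: "integrable M (\<lambda>\<omega>. (norm (g \<omega> - m \<omega>))\<^sup>2)"
    using le by (intro integrableI_nonneg) (auto simp: le_less_trans)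
  then show "square_integrable M (\<lambda>\<omega>. g \<omega> - m \<omega>)"
    by (simp add: square_integrable_def)
  show "(\<integral>\<omega>. (norm (g \<omega> - m \<omega>))\<^sup>2 \<partial>M) \<le> \<sigma>\<^sup>2"
    using le by (subst (asm) nn_integral_eq_integral[OF int]) auto
qed

text \<open>\<open>Z\<close> is known given \<open>N\<close>, and \<open>g - m\<close> has
  conditional mean zero. The conditional expectation is that of real-valued functions, hence the
  passage to coordinates.\<close>

lemma cond_unbiased_orthogonal:
  fixes g m Z :: "'a \<Rightarrow> real^'n"
  assumes cu: "cond_unbiased M N \<sigma> g m" and N: "subalgebra M N"
    and m [measurable]: "m \<in> borel_measurable N"
    and Z [measurable]: "Z \<in> borel_measurable N" and Z2: "square_integrable M Z"
  shows "(\<integral>\<omega>. Z \<omega> \<bullet> (g \<omega> - m \<omega>) \<partial>M) = 0"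
proof -
  interpret sigma_finite_subalgebra M N using N by (rule sigma_finite_subalgebraI)
  have [measurable]: "m \<in> borel_measurable M" "g \<in> borel_measurable M" "Z \<in> borel_measurable M"
    using measurable_from_subalg[OF N m] measurable_from_subalg[OF N Z] cu by (auto simp: cond_unbiased_def)
  have gm: "square_integrable M (\<lambda>\<omega>. g \<omega> - m \<omega>)" by (rule cond_unbiased_variance[OF cu N m])
  have comp: "square_integrable M (\<lambda>\<omega>. w \<omega> $ i)" if "square_integrable M w" for w :: "'a \<Rightarrow> real^'n" and i
  proof -
    have [measurable]: "w \<in> borel_measurable M" using that by (rule square_integrableD)
    show ?thesis by (rule square_integrable_bound[OF that]) (auto simp: component_le_norm_cart)
  qed
  have int: "integrable M (\<lambda>\<omega>. Z \<omega> $ i * (g \<omega> - m \<omega>) $ i)" for i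
    using square_integrable_inner[OF comp[OF Z2, of i] comp[OF gm, of i]] by simp
  have zero: "(\<integral>\<omega>. Z \<omega> $ i * (g \<omega> - m \<omega>) $ i \<partial>M) = 0" for i
  proof -
    have ig: "integrable M (\<lambda>\<omega>. g \<omega> $ i)"
      using integrable_inner_left[of "axis i 1" M g] cu by (simp add: cond_unbiased_def inner_axis)
    have ce: "AE \<omega> in M. real_cond_exp M N (\<lambda>\<omega>. g \<omega> $ i) \<omega> = m \<omega> $ i"
      using cu by (simp add: cond_unbiased_def)
    \<comment> \<open>Integrability of the mean is inherited from \<open>g\<close>: it agrees almost
      everywhere with a conditional expectation of an integrable function.\<close>
    have im: "integrable M (\<lambda>\<omega>. m \<omega> $ i)"
      by (rule integrable_cong_AE_imp[OF real_cond_exp_int(1)[OF ig] _ ce]) measurable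
    have "AE \<omega> in M. real_cond_exp M N (\<lambda>\<omega>. m \<omega> $ i) \<omega> = m \<omega> $ i"
      by (rule real_cond_exp_F_meas[OF im]) measurable
    with real_cond_exp_diff[OF ig im] ce
    have "AE \<omega> in M. Z \<omega> $ i * real_cond_exp M N (\<lambda>\<omega>. (g \<omega> - m \<omega>) $ i) \<omega> = 0"
      by eventually_elim simp
    then have "(\<integral>\<omega>. Z \<omega> $ i * real_cond_exp M N (\<lambda>\<omega>. (g \<omega> - m \<omega>) $ i) \<omega> \<partial>M) = 0"
      by (rule integral_eq_zero_AE)
    moreover have "(\<integral>\<omega>. Z \<omega> $ i * (g \<omega> - m \<omega>) $ i \<partial>M)
        = (\<integral>\<omega>. Z \<omega> $ i * real_cond_exp M N (\<lambda>\<omega>. (g \<omega> - m \<omega>) $ i) \<omega> \<partial>M)"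
      by (rule real_cond_exp_intg(2)[OF int, symmetric]) measurable
    ultimately show ?thesis by simp
  qed
  have "(\<integral>\<omega>. Z \<omega> \<bullet> (g \<omega> - m \<omega>) \<partial>M) = (\<Sum>i\<in>UNIV. (\<integral>\<omega>. Z \<omega> $ i * (g \<omega> - m \<omega>) $ i \<partial>M))"
    unfolding inner_vec_def inner_real_def by (rule Bochner_Integration.integral_sum[OF int])
  then show ?thesis using zero by simp
qed

text \<open>Orthogonality removes the cross term. In the recursions \<open>Z\<close> is the part of
  the new error known before the oracle call, and \<open>c\<close> is \<open>\<gamma>\<close> or
  \<open>\<eta>\<^sub>y\<close>.\<close>

lemma cond_unbiased_second_moment:
  fixes g m Z :: "'a \<Rightarrow> real^'n"
  assumes cu: "cond_unbiased M N \<sigma> g m" and N: "subalgebra M N"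
    and m: "m \<in> borel_measurable N"
    and Z: "Z \<in> borel_measurable N" and Z2: "square_integrable M Z"
  shows "(\<integral>\<omega>. (norm (Z \<omega> + c *\<^sub>R (g \<omega> - m \<omega>)))\<^sup>2 \<partial>M) \<le> (\<integral>\<omega>. (norm (Z \<omega>))\<^sup>2 \<partial>M) + c\<^sup>2 * \<sigma>\<^sup>2"
proof -
  note gm = cond_unbiased_variance[OF cu N m]
  have expand: "(norm (a + c *\<^sub>R b))\<^sup>2 = (norm a)\<^sup>2 + 2 * c * (a \<bullet> b) + c\<^sup>2 * (norm b)\<^sup>2"
    for a b :: "real^'n"
    unfolding power2_norm_eq_inner
    by (simp add: inner_add_left inner_add_right inner_commute algebra_simps power2_eq_square)
  have "(\<integral>\<omega>. (norm (Z \<omega> + c *\<^sub>R (g \<omega> - m \<omega>)))\<^sup>2 \<partial>M) =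
    (\<integral>\<omega>. (norm (Z \<omega>))\<^sup>2 + 2 * c * (Z \<omega> \<bullet> (g \<omega> - m \<omega>)) + c\<^sup>2 * (norm (g \<omega> - m \<omega>))\<^sup>2 \<partial>M)"
    by (simp only: expand)
  also have "\<dots> = (\<integral>\<omega>. (norm (Z \<omega>))\<^sup>2 \<partial>M) + 2 * c * (\<integral>\<omega>. Z \<omega> \<bullet> (g \<omega> - m \<omega>) \<partial>M)
      + c\<^sup>2 * (\<integral>\<omega>. (norm (g \<omega> - m \<omega>))\<^sup>2 \<partial>M)"
    using square_integrableD(2)[OF Z2] square_integrableD(2)[OF gm(1)] square_integrable_inner[OF Z2 gm(1)]
    by simp
  also have "\<dots> \<le> (\<integral>\<omega>. (norm (Z \<omega>))\<^sup>2 \<partial>M) + c\<^sup>2 * \<sigma>\<^sup>2"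
    using cond_unbiased_orthogonal[OF assms] gm(2) by (simp add: mult_left_mono)
  finally show ?thesis .
qed

end

lemma square_integrable_bound2:
  assumes "square_integrable M g\<^sub>1" "square_integrable M g\<^sub>2" "f \<in> borel_measurable M"
    and le: "AE \<omega> in M. norm (f \<omega>) \<le> a * norm (g\<^sub>1 \<omega>) + b * norm (g\<^sub>2 \<omega>)"
  shows "square_integrable M f"
proof (rule square_integrable_bound[OF _ assms(3)])
  show "square_integrable M (\<lambda>\<omega>. a *\<^sub>R norm (g\<^sub>1 \<omega>) + b *\<^sub>R norm (g\<^sub>2 \<omega>))"
    by (intro square_integrable_add square_integrable_scaleR square_integrable_norm assms)
  show "AE \<omega> in M. norm (f \<omega>) \<le> norm (a *\<^sub>R norm (g\<^sub>1 \<omega>) + b *\<^sub>R norm (g\<^sub>2 \<omega>))"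
    using le by eventually_elim simp
qed

subsection \<open>The error recursions\<close>

lemma norm_add_square_young:
  fixes a b :: "'a::real_inner"
  assumes "0 < \<theta>"
  shows "(norm (a + b))\<^sup>2 \<le> (1 + \<theta>) * (norm a)\<^sup>2 + (1 + 1 / \<theta>) * (norm b)\<^sup>2"
proof -
  have "0 \<le> (norm (\<theta> *\<^sub>R a - b))\<^sup>2" by simp
  then have "2 * \<theta> * (a \<bullet> b) \<le> \<theta>\<^sup>2 * (a \<bullet> a) + b \<bullet> b"
    unfolding power2_norm_eq_inner
    by (simp add: inner_diff_left inner_diff_right inner_commute algebra_simps power2_eq_square)
  then have "2 * (a \<bullet> b) \<le> \<theta> * (a \<bullet> a) + (1 / \<theta>) * (b \<bullet> b)"
    using assms by (simp add: field_simps power2_eq_square)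
  then show ?thesis
    unfolding power2_norm_eq_inner
    by (simp add: inner_add_left inner_add_right inner_commute algebra_simps)
qed

text \<open>The two sides differ by \<open>\<gamma> * (1 - \<gamma>) * (norm (a - b))^2\<close>.
  Convexity keeps the full factor \<open>1 - \<gamma>\<close>, so the contraction budget is left for
  the drift.\<close>

lemma norm_convex_combination_square_le:
  fixes a b :: "'a::real_inner"
  assumes "0 \<le> \<gamma>" "\<gamma> \<le> 1"
  shows "(norm ((1 - \<gamma>) *\<^sub>R a + \<gamma> *\<^sub>R b))\<^sup>2 \<le> (1 - \<gamma>) * (norm a)\<^sup>2 + \<gamma> * (norm b)\<^sup>2"
proof -
  have "(1 - \<gamma>) * (norm a)\<^sup>2 + \<gamma> * (norm b)\<^sup>2 - (norm ((1 - \<gamma>) *\<^sub>R a + \<gamma> *\<^sub>R b))\<^sup>2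
      = \<gamma> * (1 - \<gamma>) * (norm (a - b))\<^sup>2"
    unfolding power2_norm_eq_inner
    by (simp add: inner_add_left inner_add_right inner_diff_left inner_diff_right inner_commute
        algebra_simps)
  moreover have "0 \<le> \<gamma> * (1 - \<gamma>) * (norm (a - b))\<^sup>2" using assms by simp
  ultimately show ?thesis by linarith
qed

lemma norm_mult_vec_le:
  fixes s v :: "real^'n"
  assumes "\<And>i. \<bar>s $ i\<bar> \<le> c"
  shows "norm (s * v) \<le> c * norm v"
proof -
  have "0 \<le> c" using assms abs_ge_zero order_trans by blast
  have "norm (s * v) \<le> norm (c *\<^sub>R v)"
    using assms \<open>0 \<le> c\<close> by (intro norm_le_componentwise_cart) (auto simp: abs_mult intro!: mult_right_mono)
  then show ?thesis using \<open>0 \<le> c\<close> by simp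
qed

text \<open>In each coordinate \<open>2 * g * v = g^2 + v^2 - (v - g)^2\<close>; the lower bound on
  the scaling is applied to the first two squares and the upper bound to the last. The square of
  \<open>v\<close> is kept because it later pays for curvature and drift.\<close>

lemma inner_mult_vec_ge:
  fixes g s v :: "real^'n"
  assumes "\<And>i. l \<le> s $ i" "\<And>i. s $ i \<le> c"
  shows "l / 2 * (norm g)\<^sup>2 + l / 2 * (norm v)\<^sup>2 - c / 2 * (norm (v - g))\<^sup>2 \<le> g \<bullet> (s * v)"
proof -
  have "l / 2 * (g $ i)\<^sup>2 + l / 2 * (v $ i)\<^sup>2 - c / 2 * ((v - g) $ i)\<^sup>2 \<le> g $ i * (s * v) $ i" for i
  proof -
    have "l * (g $ i)\<^sup>2 \<le> s $ i * (g $ i)\<^sup>2" "l * (v $ i)\<^sup>2 \<le> s $ i * (v $ i)\<^sup>2"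
      "s $ i * (v $ i - g $ i)\<^sup>2 \<le> c * (v $ i - g $ i)\<^sup>2"
      using assms by (intro mult_right_mono; simp)+
    then show ?thesis by (simp add: power2_eq_square algebra_simps)
  qed
  then have "(\<Sum>i\<in>UNIV. l / 2 * (g $ i)\<^sup>2 + l / 2 * (v $ i)\<^sup>2 - c / 2 * ((v - g) $ i)\<^sup>2)
      \<le> (\<Sum>i\<in>UNIV. g $ i * (s * v) $ i)"
    by (intro sum_mono)
  then show ?thesis
    unfolding power2_norm_eq_inner
    by (simp add: inner_vec_def sum_subtractf sum.distrib sum_distrib_left power2_eq_square)
qed

text \<open>The momentum parameter is instantiated as \<open>1 - \<gamma>\<close>, so that the
  weight of the fresh gradient is \<open>\<gamma>\<close>. The last three bounds are the step-size
  restrictions that a large \<open>T\<close> will provide.\<close>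

locale pdsm_analysis =
  minimax_problem f grad_x grad_y grad_F Y L\<^sub>F L\<^sub>f \<mu> +
  pdsm_run M F Y grad_x grad_y \<sigma> x\<^sub>0 v\<^sub>0 y\<^sub>0 "1 - \<gamma>" \<eta>\<^sub>x \<eta>\<^sub>y G\<^sub>0 c\<^sub>l c\<^sub>u T Ox Oy h x v u y
  for f :: "real^'d \<Rightarrow> real^'e \<Rightarrow> real"
    and grad_x :: "real^'d \<Rightarrow> real^'e \<Rightarrow> real^'d"
    and grad_y :: "real^'d \<Rightarrow> real^'e \<Rightarrow> real^'e"
    and grad_F :: "real^'d \<Rightarrow> real^'d"
    and Y :: "(real^'e) set"
    and L\<^sub>F L\<^sub>f \<mu> :: real
    and M :: "'w measure" and F :: "nat \<Rightarrow> 'w measure"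
    and \<sigma> :: real
    and x\<^sub>0 v\<^sub>0 :: "real^'d" and y\<^sub>0 :: "real^'e"
    and \<gamma> \<eta>\<^sub>x \<eta>\<^sub>y G\<^sub>0 c\<^sub>l c\<^sub>u :: real
    and T :: nat
    and Ox :: "nat \<Rightarrow> 'w \<Rightarrow> real^'d \<Rightarrow> real^'e \<Rightarrow> real^'d"
    and Oy :: "nat \<Rightarrow> 'w \<Rightarrow> real^'d \<Rightarrow> real^'e \<Rightarrow> real^'e"
    and h :: "nat \<Rightarrow> (real^'d) list \<Rightarrow> real^'d"
    and x v u :: "nat \<Rightarrow> 'w \<Rightarrow> real^'d" and y :: "nat \<Rightarrow> 'w \<Rightarrow> real^'e" +
  assumes y0_in_Y: "y\<^sub>0 \<in> Y"
    and gamma: "0 < \<gamma>" "\<gamma> \<le> 1"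
    and eta_x_pos: "0 < \<eta>\<^sub>x" and eta_y_pos: "0 < \<eta>\<^sub>y"
    and c_pos: "0 < c\<^sub>l" "0 < c\<^sub>u"
    and eta_x_small: "\<eta>\<^sub>x * L\<^sub>F * c\<^sub>u\<^sup>2 \<le> c\<^sub>l / 4"
    and eta_y_small: "\<eta>\<^sub>y * \<mu> \<le> 1" "\<eta>\<^sub>y * L\<^sub>f\<^sup>2 \<le> \<mu> / 4"
begin

abbreviation "ox t \<omega> \<equiv> Ox t \<omega> (x t \<omega>) (y t \<omega>)"
abbreviation "oy t \<omega> \<equiv> Oy t \<omega> (x t \<omega>) (y t \<omega>)"
abbreviation "gx t \<omega> \<equiv> grad_x (x t \<omega>) (y t \<omega>)"
abbreviation "gy t \<omega> \<equiv> grad_y (x t \<omega>) (y t \<omega>)"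
abbreviation "gF t \<omega> \<equiv> grad_F (x t \<omega>)"
abbreviation "p t \<omega> \<equiv> ystar (x t \<omega>) (y t \<omega>)"

section \<open>Adaptedness and pathwise descent\<close>

lemma measurable_F_M: "w \<in> borel_measurable (F t) \<Longrightarrow> w \<in> borel_measurable M"
  by (rule measurable_from_subalg[OF F_sub])

lemma measurable_F_Suc: "w \<in> borel_measurable (F t) \<Longrightarrow> w \<in> borel_measurable (F (Suc t))"
  using sets_F_mono[of t "Suc t"] space_F[of t] space_F[of "Suc t"] by (auto simp: measurable_def)

lemma measurable_F_cong:
  "(\<And>\<omega>. \<omega> \<in> space M \<Longrightarrow> w \<omega> = w' \<omega>) \<Longrightarrow> w' \<in> borel_measurable (F t) \<Longrightarrow> w \<in> borel_measurable (F t)"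
  by (subst measurable_cong[of _ w w']) (auto simp: space_F)

lemma iterates_adapted:
  assumes "t \<le> Suc T"
  shows "x t \<in> borel_measurable (F t) \<and> v t \<in> borel_measurable (F t) \<and> y t \<in> borel_measurable (F t)"
  using assms
proof (induction t)
  case 0
  have "x 0 \<in> borel_measurable (F 0)"
    by (rule measurable_F_cong[where w' = "\<lambda>_. x\<^sub>0"]) (simp_all add: init)
  moreover have "v 0 \<in> borel_measurable (F 0)"
    by (rule measurable_F_cong[where w' = "\<lambda>_. v\<^sub>0"]) (simp_all add: init)
  moreover have "y 0 \<in> borel_measurable (F 0)"
    by (rule measurable_F_cong[where w' = "\<lambda>_. y\<^sub>0"]) (simp_all add: init)
  ultimately show ?case by blast
next
  case (Suc t)
  then have t: "t \<le> T" by simp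
  have [measurable]: "x t \<in> borel_measurable (F (Suc t))" "v t \<in> borel_measurable (F (Suc t))"
    "y t \<in> borel_measurable (F (Suc t))"
    using Suc by (auto intro: measurable_F_Suc)
  have [measurable]: "ox t \<in> borel_measurable (F (Suc t))" "oy t \<in> borel_measurable (F (Suc t))"
    "u (Suc t) \<in> borel_measurable (F (Suc t))"
    using Ox_adapted[OF t] Oy_adapted[OF t] u_adapted[OF t] by simp_all
  have v' [measurable]: "v (Suc t) \<in> borel_measurable (F (Suc t))"
    by (rule measurable_F_cong[OF v_step[OF t]]) measurable
  have [measurable]: "(\<lambda>\<omega>. scaling G\<^sub>0 (u (Suc t) \<omega>) * v (Suc t) \<omega>) \<in> borel_measurable (F (Suc t))"
    by (rule borel_measurable_vecI) (simp add: scaling_def)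
  have x': "x (Suc t) \<in> borel_measurable (F (Suc t))"
    by (rule measurable_F_cong[OF x_step[OF t]]) measurable
  have "closest_point Y \<in> borel_measurable borel"
    using y0_in_Y by (intro borel_measurable_continuous_onI continuous_on_closest_point convex_Y closed_Y) auto
  then have [measurable]: "(\<lambda>\<omega>. closest_point Y (w \<omega>)) \<in> borel_measurable (F (Suc t))"
    if "w \<in> borel_measurable (F (Suc t))" for w
    using that by (rule measurable_compose_rev)
  have y': "y (Suc t) \<in> borel_measurable (F (Suc t))"
    by (rule measurable_F_cong[OF y_step[OF t]]) measurable
  show ?case using v' x' y' by blast
qed

lemma y_in_Y: "t \<le> Suc T \<Longrightarrow> \<omega> \<in> space M \<Longrightarrow> y t \<omega> \<in> Y"
  by (cases t) (use init y0_in_Y y_step closest_point_in_set[OF closed_Y] in auto)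

text \<open>The gradients are known to be continuous only on \<open>UNIV \<times> Y\<close>.
  Inserting the projection onto \<open>Y\<close> yields a function continuous on the whole space
  that agrees with \<open>G\<close> along the run, where \<open>y t\<close> stays in
  \<open>Y\<close>.\<close>

lemma continuous_composition_adapted:
  fixes G :: "(real^'d) \<times> (real^'e) \<Rightarrow> 'b::topological_space"
  assumes "continuous_on (UNIV \<times> Y) G" and "t \<le> Suc T"
  shows "(\<lambda>\<omega>. G (x t \<omega>, y t \<omega>)) \<in> borel_measurable (F t)"
proof -
  note m[measurable] = iterates_adapted[OF assms(2), THEN conjunct1]
    iterates_adapted[OF assms(2), THEN conjunct2, THEN conjunct2]
  have "continuous_on UNIV (\<lambda>z. G (fst z, closest_point Y (snd z)))"
    using y0_in_Y closest_point_in_set[OF closed_Y]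
    by (intro continuous_on_compose2[OF assms(1)] continuous_intros
        continuous_on_compose2[OF continuous_on_closest_point[of Y UNIV]] convex_Y closed_Y) auto
  then have "(\<lambda>z. G (fst z, closest_point Y (snd z))) \<in> borel_measurable borel"
    by (rule borel_measurable_continuous_onI)
  moreover have "(\<lambda>\<omega>. (x t \<omega>, y t \<omega>)) \<in> borel_measurable (F t)"
    by measurable
  ultimately have "(\<lambda>\<omega>. G (fst (x t \<omega>, y t \<omega>), closest_point Y (snd (x t \<omega>, y t \<omega>)))) \<in> borel_measurable (F t)"
    by (rule measurable_compose_rev)
  then show ?thesis
    by (rule measurable_F_cong[rotated]) (simp add: y_in_Y[OF assms(2)] closest_point_self)
qed

lemma continuous_grads: "continuous_on (UNIV \<times> Y) (\<lambda>z. grad_x (fst z) (snd z))"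
    "continuous_on (UNIV \<times> Y) (\<lambda>z. grad_y (fst z) (snd z))"
  using continuous_on_fst[OF lipschitz_on_continuous_on[OF grad_lipschitz]]
    continuous_on_snd[OF lipschitz_on_continuous_on[OF grad_lipschitz]] by simp_all

lemma gx_adapted: "t \<le> Suc T \<Longrightarrow> gx t \<in> borel_measurable (F t)"
  using continuous_composition_adapted[OF continuous_grads(1)] by simp

lemma gy_adapted: "t \<le> Suc T \<Longrightarrow> gy t \<in> borel_measurable (F t)"
  using continuous_composition_adapted[OF continuous_grads(2)] by simp

lemma p_adapted: "t \<le> Suc T \<Longrightarrow> p t \<in> borel_measurable (F t)"
  using continuous_composition_adapted[OF continuous_on_subset[OF continuous_ystar]] by simp

lemma gyp_adapted: "t \<le> Suc T \<Longrightarrow> (\<lambda>\<omega>. grad_y (x t \<omega>) (p t \<omega>)) \<in> borel_measurable (F t)"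
proof -
  have "continuous_on (UNIV \<times> Y) (\<lambda>z. (\<lambda>z. grad_y (fst z) (snd z)) (fst z, ystar (fst z) (snd z)))"
    by (rule continuous_on_compose2[OF continuous_grads(2)])
      (auto intro!: continuous_intros continuous_on_subset[OF continuous_ystar] simp: ystar_in_Y)
  from continuous_composition_adapted[OF this] show "t \<le> Suc T \<Longrightarrow> ?thesis" by simp
qed

lemma gF_adapted: "t \<le> Suc T \<Longrightarrow> gF t \<in> borel_measurable (F t)"
proof -
  have "continuous_on (UNIV \<times> Y) (\<lambda>z. grad_F (fst z))"
    by (rule continuous_on_compose2[OF lipschitz_on_continuous_on[OF grad_F_lipschitz_on]])
      (auto intro!: continuous_intros)
  from continuous_composition_adapted[OF this] show "t \<le> Suc T \<Longrightarrow> ?thesis" by simp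
qed

lemma scaling_bounds_AE:
  assumes "t \<le> T"
  shows "AE \<omega> in M. \<forall>i. c\<^sub>l \<le> scaling G\<^sub>0 (u (Suc t) \<omega>) $ i \<and> scaling G\<^sub>0 (u (Suc t) \<omega>) $ i \<le> c\<^sub>u"
  by (rule eventually_all_finite) (rule scaling_bounds[OF assms])

lemma x_step_bound:
  assumes "t \<le> T"
  shows "AE \<omega> in M. norm (x (Suc t) \<omega> - x t \<omega>) \<le> \<eta>\<^sub>x * c\<^sub>u * norm (v (Suc t) \<omega>)"
  using scaling_bounds_AE[OF assms]
proof (rule AE_mp, intro AE_I2 impI)
  fix \<omega> assume \<omega>: "\<omega> \<in> space M"
    and s: "\<forall>i. c\<^sub>l \<le> scaling G\<^sub>0 (u (Suc t) \<omega>) $ i \<and> scaling G\<^sub>0 (u (Suc t) \<omega>) $ i \<le> c\<^sub>u"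
  have "norm (scaling G\<^sub>0 (u (Suc t) \<omega>) * v (Suc t) \<omega>) \<le> c\<^sub>u * norm (v (Suc t) \<omega>)"
    using s c_pos by (intro norm_mult_vec_le) (smt (verit))
  then show "norm (x (Suc t) \<omega> - x t \<omega>) \<le> \<eta>\<^sub>x * c\<^sub>u * norm (v (Suc t) \<omega>)"
    using eta_x_pos by (simp add: x_step[OF assms \<omega>] mult_left_mono mult.assoc)
qed

text \<open>Of the gain \<open>\<eta>\<^sub>x * c\<^sub>l / 2\<close> in the squared norm of
  \<open>v (Suc t)\<close>, one half pays for the curvature term through \<open>eta_x_small\<close>;
  the other half remains to absorb the drifts.\<close>

lemma descent_AE:
  assumes "t \<le> T"
  shows "AE \<omega> in M. \<eta>\<^sub>x * c\<^sub>l / 2 * (norm (gF t \<omega>))\<^sup>2 + \<eta>\<^sub>x * c\<^sub>l / 4 * (norm (v (Suc t) \<omega>))\<^sup>2 \<le>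
     primal_function f Y (x t \<omega>) - primal_function f Y (x (Suc t) \<omega>)
     + \<eta>\<^sub>x * c\<^sub>u / 2 * (norm (v (Suc t) \<omega> - gF t \<omega>))\<^sup>2"
  using scaling_bounds_AE[OF assms] x_step_bound[OF assms]
proof (rule AE_mp[OF AE_conjI], intro AE_I2 impI, elim conjE)
  fix \<omega> assume \<omega>: "\<omega> \<in> space M"
    and s: "\<forall>i. c\<^sub>l \<le> scaling G\<^sub>0 (u (Suc t) \<omega>) $ i \<and> scaling G\<^sub>0 (u (Suc t) \<omega>) $ i \<le> c\<^sub>u"
    and step: "norm (x (Suc t) \<omega> - x t \<omega>) \<le> \<eta>\<^sub>x * c\<^sub>u * norm (v (Suc t) \<omega>)"
  let ?g = "gF t \<omega>" and ?v = "v (Suc t) \<omega>" and ?s = "scaling G\<^sub>0 (u (Suc t) \<omega>)"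
  have "c\<^sub>l / 2 * (norm ?g)\<^sup>2 + c\<^sub>l / 2 * (norm ?v)\<^sup>2 - c\<^sub>u / 2 * (norm (?v - ?g))\<^sup>2 \<le> ?g \<bullet> (?s * ?v)"
    using s by (intro inner_mult_vec_ge) auto
  from mult_left_mono[OF this, of \<eta>\<^sub>x]
  have inner: "?g \<bullet> (x (Suc t) \<omega> - x t \<omega>) \<le> \<eta>\<^sub>x * c\<^sub>u / 2 * (norm (?v - ?g))\<^sup>2
      - \<eta>\<^sub>x * c\<^sub>l / 2 * (norm ?g)\<^sup>2 - \<eta>\<^sub>x * c\<^sub>l / 2 * (norm ?v)\<^sup>2"
    using eta_x_pos by (simp add: x_step[OF assms \<omega>] algebra_simps)
  have "L\<^sub>F * (norm (x (Suc t) \<omega> - x t \<omega>))\<^sup>2 \<le> L\<^sub>F * (\<eta>\<^sub>x * c\<^sub>u * norm ?v)\<^sup>2"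
    using step lipschitz_on_nonneg[OF grad_F_lipschitz_on] by (intro mult_left_mono power_mono) auto
  also have "\<dots> = \<eta>\<^sub>x * (\<eta>\<^sub>x * L\<^sub>F * c\<^sub>u\<^sup>2) * (norm ?v)\<^sup>2"
    by (simp add: power2_eq_square algebra_simps)
  also have "\<dots> \<le> \<eta>\<^sub>x * (c\<^sub>l / 4) * (norm ?v)\<^sup>2"
    using eta_x_small eta_x_pos by (intro mult_right_mono mult_left_mono) auto
  finally have quad: "L\<^sub>F * (norm (x (Suc t) \<omega> - x t \<omega>))\<^sup>2 \<le> \<eta>\<^sub>x * c\<^sub>l / 4 * (norm ?v)\<^sup>2" by simp
  have "primal_function f Y (x (Suc t) \<omega>) \<le> primal_function f Y (x t \<omega>)
      + ?g \<bullet> (x (Suc t) \<omega> - x t \<omega>) + L\<^sub>F * (norm (x (Suc t) \<omega> - x t \<omega>))\<^sup>2"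
    using primal_descent[of "x t \<omega>" "x (Suc t) \<omega> - x t \<omega>"] by simp
  with inner quad show "\<eta>\<^sub>x * c\<^sub>l / 2 * (norm ?g)\<^sup>2 + \<eta>\<^sub>x * c\<^sub>l / 4 * (norm ?v)\<^sup>2 \<le>
     primal_function f Y (x t \<omega>) - primal_function f Y (x (Suc t) \<omega>)
     + \<eta>\<^sub>x * c\<^sub>u / 2 * (norm (?v - ?g))\<^sup>2"
    by linarith
qed

section \<open>Second moments of the iterates\<close>

lemma gx_square_integrable:
  assumes "t \<le> Suc T" "square_integrable M (x t)" "square_integrable M (y t)"
  shows "square_integrable M (gx t)" "square_integrable M (gy t)"
proof -
  note m[measurable] = measurable_F_M[OF gx_adapted[OF assms(1)]] measurable_F_M[OF gy_adapted[OF assms(1)]]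
  have dx: "square_integrable M (\<lambda>\<omega>. x t \<omega> - x\<^sub>0)" and dy: "square_integrable M (\<lambda>\<omega>. y t \<omega> - y\<^sub>0)"
    by (intro square_integrable_diff square_integrable_const assms)+
  have le: "L\<^sub>f * norm ((a, b) - (x\<^sub>0, y\<^sub>0)) \<le> L\<^sub>f * norm (a - x\<^sub>0) + L\<^sub>f * norm (b - y\<^sub>0)"
    for a and b
    using mult_left_mono[OF norm_Pair_le[of "a - x\<^sub>0" "b - y\<^sub>0"] L_nonneg] by (simp add: distrib_left)
  have "square_integrable M (\<lambda>\<omega>. gx t \<omega> - grad_x x\<^sub>0 y\<^sub>0)"
  proof (rule square_integrable_bound2[OF dx dy])
    show "AE \<omega> in M. norm (gx t \<omega> - grad_x x\<^sub>0 y\<^sub>0) \<le> L\<^sub>f * norm (x t \<omega> - x\<^sub>0) + L\<^sub>f * norm (y t \<omega> - y\<^sub>0)"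
      using grad_lipschitz_dist(1)[OF y_in_Y[OF assms(1)] y0_in_Y] le
      by (intro AE_I2) (blast intro: order_trans)
  qed measurable
  from square_integrable_add[OF this square_integrable_const]
  show "square_integrable M (gx t)" by (rule square_integrable_cong[of _ _ "gx t"]) simp
  have "square_integrable M (\<lambda>\<omega>. gy t \<omega> - grad_y x\<^sub>0 y\<^sub>0)"
  proof (rule square_integrable_bound2[OF dx dy])
    show "AE \<omega> in M. norm (gy t \<omega> - grad_y x\<^sub>0 y\<^sub>0) \<le> L\<^sub>f * norm (x t \<omega> - x\<^sub>0) + L\<^sub>f * norm (y t \<omega> - y\<^sub>0)"
      using grad_lipschitz_dist(2)[OF y_in_Y[OF assms(1)] y0_in_Y] le
      by (intro AE_I2) (blast intro: order_trans)
  qed measurable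
  from square_integrable_add[OF this square_integrable_const]
  show "square_integrable M (gy t)" by (rule square_integrable_cong[of _ _ "gy t"]) simp
qed

lemma oracle_square_integrable:
  assumes "t \<le> T" "square_integrable M (x t)" "square_integrable M (y t)"
  shows "square_integrable M (ox t)" "square_integrable M (oy t)"
proof -
  have t: "t \<le> Suc T" using assms by simp
  note g = gx_square_integrable[OF t assms(2,3)]
  have "square_integrable M (\<lambda>\<omega>. (ox t \<omega> - gx t \<omega>) + gx t \<omega>)"
    by (intro square_integrable_add g cond_unbiased_variance(1)[OF Ox_unbiased[OF assms(1)] F_sub gx_adapted[OF t]])
  then show "square_integrable M (ox t)" by simp
  have "square_integrable M (\<lambda>\<omega>. (oy t \<omega> - gy t \<omega>) + gy t \<omega>)"
    by (intro square_integrable_add g cond_unbiased_variance(1)[OF Oy_unbiased[OF assms(1)] F_sub gy_adapted[OF t]])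
  then show "square_integrable M (oy t)" by simp
qed

text \<open>Finite second moments propagate from the deterministic start: Lipschitz gradients grow
  at most linearly, the noise has bounded variance, the scaling is bounded, and projection is
  nonexpansive with \<open>y t\<close> as its own projection.\<close>

lemma iterates_square_integrable:
  assumes "t \<le> Suc T"
  shows "square_integrable M (x t) \<and> square_integrable M (v t) \<and> square_integrable M (y t)"
  using assms
proof (induction t)
  case 0
  have "square_integrable M (x 0)"
    by (rule square_integrable_cong[OF square_integrable_const[of x\<^sub>0]]) (simp add: init)
  moreover have "square_integrable M (v 0)"
    by (rule square_integrable_cong[OF square_integrable_const[of v\<^sub>0]]) (simp add: init)
  moreover have "square_integrable M (y 0)"
    by (rule square_integrable_cong[OF square_integrable_const[of y\<^sub>0]]) (simp add: init)
  ultimately show ?case by blast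
next
  case (Suc t)
  then have t: "t \<le> T" and IH: "square_integrable M (x t)" "square_integrable M (v t)" "square_integrable M (y t)"
    by auto
  note o = oracle_square_integrable[OF t IH(1,3)]
  note adapted = iterates_adapted[OF \<open>Suc t \<le> Suc T\<close>]
  have v': "square_integrable M (v (Suc t))"
    by (rule square_integrable_cong[OF _ v_step[OF t]])
      (auto intro!: square_integrable_add square_integrable_scaleR IH o)
  have "square_integrable M (x (Suc t))"
  proof (rule square_integrable_bound2[OF IH(1) v'])
    show "AE \<omega> in M. norm (x (Suc t) \<omega>) \<le> 1 * norm (x t \<omega>) + (\<eta>\<^sub>x * c\<^sub>u) * norm (v (Suc t) \<omega>)"
      using x_step_bound[OF t]
    proof eventually_elim
      case (elim \<omega>)
      then show ?case using norm_triangle_sub[of "x (Suc t) \<omega>" "x t \<omega>"] by simp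
    qed
  qed (use adapted in \<open>auto intro: measurable_F_M\<close>)
  moreover have "square_integrable M (y (Suc t))"
  proof (rule square_integrable_bound2[OF IH(3) o(2)])
    show "AE \<omega> in M. norm (y (Suc t) \<omega>) \<le> 1 * norm (y t \<omega>) + \<eta>\<^sub>y * norm (oy t \<omega>)"
    proof (rule AE_I2)
      fix \<omega> assume \<omega>: "\<omega> \<in> space M"
      then have Yt: "y t \<omega> \<in> Y" using y_in_Y[of t] t by simp
      have "dist (y (Suc t) \<omega>) (y t \<omega>) \<le> dist (y t \<omega> + \<eta>\<^sub>y *\<^sub>R oy t \<omega>) (y t \<omega>)"
        using closest_point_lipschitz[OF convex_Y closed_Y, of "y t \<omega> + \<eta>\<^sub>y *\<^sub>R oy t \<omega>" "y t \<omega>"] Yt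
        by (auto simp: y_step[OF t \<omega>] closest_point_self)
      then have "norm (y (Suc t) \<omega> - y t \<omega>) \<le> \<eta>\<^sub>y * norm (oy t \<omega>)"
        using eta_y_pos by (simp add: dist_norm)
      then show "norm (y (Suc t) \<omega>) \<le> 1 * norm (y t \<omega>) + \<eta>\<^sub>y * norm (oy t \<omega>)"
        using norm_triangle_sub[of "y (Suc t) \<omega>" "y t \<omega>"] by simp
    qed
  qed (use adapted in \<open>auto intro: measurable_F_M\<close>)
  ultimately show ?case using v' by blast
qed

lemma square_integrable_iterates:
  assumes "t \<le> Suc T"
  shows "square_integrable M (x t)" "square_integrable M (v t)" "square_integrable M (y t)"
    "square_integrable M (gx t)" "square_integrable M (gy t)"
  using iterates_square_integrable[OF assms] gx_square_integrable[OF assms] by blast+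

lemma gF_square_integrable:
  assumes "t \<le> Suc T"
  shows "square_integrable M (gF t)"
proof -
  note m[measurable] = measurable_F_M[OF gF_adapted[OF assms]]
  note dx = square_integrable_diff[OF square_integrable_iterates(1)[OF assms] square_integrable_const[of x\<^sub>0]]
  have "square_integrable M (\<lambda>\<omega>. gF t \<omega> - grad_F x\<^sub>0)"
    by (rule square_integrable_bound2[OF dx dx, of _ L\<^sub>F 0])
      (use lipschitz_on_normD[OF grad_F_lipschitz_on] in \<open>auto intro!: AE_I2\<close>)
  from square_integrable_add[OF this square_integrable_const]
  show ?thesis by (rule square_integrable_cong[of _ _ "gF t"]) simp
qed

text \<open>Taking the fixed maximizer \<open>ystar x\<^sub>0 y\<^sub>0\<close> as reference,
  \<open>ystar_drift\<close> bounds the distance linearly in the iterates.\<close>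

lemma gap_square_integrable:
  assumes "t \<le> Suc T"
  shows "square_integrable M (\<lambda>\<omega>. y t \<omega> - p t \<omega>)"
proof -
  note m[measurable] = measurable_F_M[OF p_adapted[OF assms]]
    square_integrableD(1)[OF square_integrable_iterates(3)[OF assms]]
  note dx = square_integrable_diff[OF square_integrable_iterates(1)[OF assms] square_integrable_const[of x\<^sub>0]]
  note dy = square_integrable_diff[OF square_integrable_iterates(3)[OF assms] square_integrable_const[of "ystar x\<^sub>0 y\<^sub>0"]]
  show ?thesis
    by (rule square_integrable_bound2[OF dy dx, of _ 1 "2 * (L\<^sub>f / \<mu>)"])
      (use ystar_drift in \<open>auto intro!: AE_I2\<close>)
qed

end

text \<open>The recursion telescopes to a bound on \<open>r\<close> times the sum over
  \<open>t < T\<close>, plus a whole \<open>a T\<close>. Since \<open>r \<le> 1\<close>, this last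
  term covers the missing summand \<open>r * a T\<close>.\<close>

lemma sum_le_of_contraction:
  fixes a e :: "nat \<Rightarrow> real"
  assumes step: "\<And>t. t < T \<Longrightarrow> a (Suc t) \<le> (1 - r) * a t + e t"
    and "0 \<le> a T" "r \<le> 1"
  shows "r * (\<Sum>t\<le>T. a t) \<le> a 0 + (\<Sum>t<T. e t)"
proof -
  have "r * (\<Sum>t<n. a t) + a n \<le> a 0 + (\<Sum>t<n. e t)" if "n \<le> T" for n
    using that
  proof (induction n)
    case (Suc n)
    then show ?case using step[of n] by (simp add: algebra_simps)
  qed simp
  from this[of T] have "r * (\<Sum>t<T. a t) + a T \<le> a 0 + (\<Sum>t<T. e t)" by simp
  moreover have "r * a T \<le> a T" using mult_right_mono[of r 1 "a T"] assms(2,3) by simp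
  ultimately show ?thesis by (simp add: lessThan_Suc_atMost[symmetric] algebra_simps)
qed

section \<open>Recursions for the expected errors\<close>

context pdsm_analysis
begin

definition "EA t = (\<integral>\<omega>. (norm (v (Suc t) \<omega> - gF t \<omega>))\<^sup>2 \<partial>M)"
definition "EB t = (\<integral>\<omega>. (norm (v (Suc t) \<omega>))\<^sup>2 \<partial>M)"
definition "ED t = (\<integral>\<omega>. (norm (y t \<omega> - p t \<omega>))\<^sup>2 \<partial>M)"
definition "EG t = (\<integral>\<omega>. (norm (gF t \<omega>))\<^sup>2 \<partial>M)"

lemma momentum_error_square_integrable:
  "t \<le> T \<Longrightarrow> square_integrable M (\<lambda>\<omega>. v (Suc t) \<omega> - gF t \<omega>)"
  by (intro square_integrable_diff square_integrable_iterates gF_square_integrable) auto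

lemma EA_nonneg: "0 \<le> EA t" and EB_nonneg: "0 \<le> EB t" and ED_nonneg: "0 \<le> ED t" and EG_nonneg: "0 \<le> EG t"
  by (simp_all add: EA_def EB_def ED_def EG_def)

text \<open>The new error is a convex combination of the old momentum, measured against the new
  gradient, and the bias of \<open>grad_x\<close> against \<open>grad_F\<close>, plus
  \<open>\<gamma>\<close> times fresh noise. Moving the target from \<open>gF t\<close> to
  \<open>gF (Suc t)\<close> consumes half of the contraction rate.\<close>

lemma momentum_recursion:
  assumes "Suc t \<le> T"
  shows "EA (Suc t) \<le> (1 - \<gamma> / 2) * EA t
    + ((2 / \<gamma>) * ((L\<^sub>f * (1 + 2 * (L\<^sub>f / \<mu>)))\<^sup>2 * (\<eta>\<^sub>x * c\<^sub>u)\<^sup>2 * EB t) + \<gamma> * (L\<^sub>f\<^sup>2 * ED (Suc t)) + \<gamma>\<^sup>2 * \<sigma>\<^sup>2)"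
proof -
  define Lh where "Lh = L\<^sub>f * (1 + 2 * (L\<^sub>f / \<mu>))"
  define Z where "Z \<omega> = (1 - \<gamma>) *\<^sub>R (v (Suc t) \<omega> - gF (Suc t) \<omega>) + \<gamma> *\<^sub>R (gx (Suc t) \<omega> - gF (Suc t) \<omega>)" for \<omega>
  have t: "t \<le> T" "Suc t \<le> Suc T" using assms by auto
  have Lh0: "0 \<le> Lh" using L_nonneg mu_pos by (simp add: Lh_def)
  have [measurable]: "v (Suc t) \<in> borel_measurable (F (Suc t))" "gF (Suc t) \<in> borel_measurable (F (Suc t))"
    "gx (Suc t) \<in> borel_measurable (F (Suc t))"
    using iterates_adapted[OF t(2)] gF_adapted[OF t(2)] gx_adapted[OF t(2)] by auto
  have Zm: "Z \<in> borel_measurable (F (Suc t))"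
    unfolding Z_def by measurable
  have Z2: "square_integrable M Z"
    unfolding Z_def
    by (intro square_integrable_add square_integrable_scaleR square_integrable_diff
        square_integrable_iterates gF_square_integrable t)
  have "EA (Suc t) = (\<integral>\<omega>. (norm (Z \<omega> + \<gamma> *\<^sub>R (ox (Suc t) \<omega> - gx (Suc t) \<omega>)))\<^sup>2 \<partial>M)"
    unfolding EA_def
  proof (rule Bochner_Integration.integral_cong[OF refl])
    fix \<omega> assume "\<omega> \<in> space M"
    then have "v (Suc (Suc t)) \<omega> - gF (Suc t) \<omega> = Z \<omega> + \<gamma> *\<^sub>R (ox (Suc t) \<omega> - gx (Suc t) \<omega>)"
      by (simp add: v_step[OF assms] Z_def algebra_simps)
    then show "(norm (v (Suc (Suc t)) \<omega> - gF (Suc t) \<omega>))\<^sup>2 = (norm (Z \<omega> + \<gamma> *\<^sub>R (ox (Suc t) \<omega> - gx (Suc t) \<omega>)))\<^sup>2"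
      by simp
  qed
  also have "\<dots> \<le> (\<integral>\<omega>. (norm (Z \<omega>))\<^sup>2 \<partial>M) + \<gamma>\<^sup>2 * \<sigma>\<^sup>2"
    by (rule cond_unbiased_second_moment[OF Ox_unbiased[OF assms] F_sub gx_adapted[OF t(2)] Zm Z2])
  also have "(\<integral>\<omega>. (norm (Z \<omega>))\<^sup>2 \<partial>M) \<le>
    (\<integral>\<omega>. (1 - \<gamma> / 2) * (norm (v (Suc t) \<omega> - gF t \<omega>))\<^sup>2
      + (2 / \<gamma>) * (Lh\<^sup>2 * (\<eta>\<^sub>x * c\<^sub>u)\<^sup>2 * (norm (v (Suc t) \<omega>))\<^sup>2)
      + \<gamma> * (L\<^sub>f\<^sup>2 * (norm (y (Suc t) \<omega> - p (Suc t) \<omega>))\<^sup>2) \<partial>M)"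
  proof (rule integral_mono_AE)
    show "integrable M (\<lambda>\<omega>. (norm (Z \<omega>))\<^sup>2)" using Z2 by (rule square_integrableD)
    show "integrable M (\<lambda>\<omega>. (1 - \<gamma> / 2) * (norm (v (Suc t) \<omega> - gF t \<omega>))\<^sup>2
      + (2 / \<gamma>) * (Lh\<^sup>2 * (\<eta>\<^sub>x * c\<^sub>u)\<^sup>2 * (norm (v (Suc t) \<omega>))\<^sup>2)
      + \<gamma> * (L\<^sub>f\<^sup>2 * (norm (y (Suc t) \<omega> - p (Suc t) \<omega>))\<^sup>2))"
      by (intro Bochner_Integration.integrable_add integrable_mult_right square_integrableD
          momentum_error_square_integrable square_integrable_iterates gap_square_integrable t)
    show "AE \<omega> in M. (norm (Z \<omega>))\<^sup>2 \<le> (1 - \<gamma> / 2) * (norm (v (Suc t) \<omega> - gF t \<omega>))\<^sup>2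
      + (2 / \<gamma>) * (Lh\<^sup>2 * (\<eta>\<^sub>x * c\<^sub>u)\<^sup>2 * (norm (v (Suc t) \<omega>))\<^sup>2)
      + \<gamma> * (L\<^sub>f\<^sup>2 * (norm (y (Suc t) \<omega> - p (Suc t) \<omega>))\<^sup>2)"
      using x_step_bound[OF t(1)]
    proof (rule AE_mp, intro AE_I2 impI)
      fix \<omega> assume \<omega>: "\<omega> \<in> space M" and step: "norm (x (Suc t) \<omega> - x t \<omega>) \<le> \<eta>\<^sub>x * c\<^sub>u * norm (v (Suc t) \<omega>)"
      let ?a = "v (Suc t) \<omega> - gF t \<omega>" and ?b = "gF t \<omega> - gF (Suc t) \<omega>"
      have b: "(norm ?b)\<^sup>2 \<le> Lh\<^sup>2 * (\<eta>\<^sub>x * c\<^sub>u)\<^sup>2 * (norm (v (Suc t) \<omega>))\<^sup>2"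
      proof -
        have "norm ?b \<le> Lh * norm (x (Suc t) \<omega> - x t \<omega>)"
          using grad_F_lipschitz[of "x t \<omega>" "x (Suc t) \<omega>"] by (simp add: Lh_def norm_minus_commute)
        also have "\<dots> \<le> Lh * (\<eta>\<^sub>x * c\<^sub>u * norm (v (Suc t) \<omega>))"
          using step Lh0 by (rule mult_left_mono)
        finally have "(norm ?b)\<^sup>2 \<le> (Lh * (\<eta>\<^sub>x * c\<^sub>u * norm (v (Suc t) \<omega>)))\<^sup>2"
          by (rule power_mono) simp
        then show ?thesis by (simp add: power_mult_distrib mult.assoc)
      qed
      have c: "(norm (gx (Suc t) \<omega> - gF (Suc t) \<omega>))\<^sup>2 \<le> L\<^sub>f\<^sup>2 * (norm (y (Suc t) \<omega> - p (Suc t) \<omega>))\<^sup>2"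
        using power_mono[OF grad_x_error[OF y_in_Y[OF t(2) \<omega>], of "x (Suc t) \<omega>"] norm_ge_zero, of 2]
        by (simp add: power_mult_distrib)
      have "(norm (Z \<omega>))\<^sup>2 \<le> (1 - \<gamma>) * (norm (v (Suc t) \<omega> - gF (Suc t) \<omega>))\<^sup>2
          + \<gamma> * (norm (gx (Suc t) \<omega> - gF (Suc t) \<omega>))\<^sup>2"
        unfolding Z_def using gamma by (intro norm_convex_combination_square_le) auto
      moreover have "(1 - \<gamma>) * (norm (v (Suc t) \<omega> - gF (Suc t) \<omega>))\<^sup>2
          \<le> (1 - \<gamma> / 2) * (norm ?a)\<^sup>2 + (2 / \<gamma>) * (norm ?b)\<^sup>2"
      proof -
        \<comment> \<open>Young's inequality with parameter \<open>\<gamma> / 2\<close>, small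
          enough that \<open>(1 - \<gamma>) * (1 + \<gamma> / 2)\<close> is still at most
          \<open>1 - \<gamma> / 2\<close>.\<close>
        have "(norm (v (Suc t) \<omega> - gF (Suc t) \<omega>))\<^sup>2 \<le> (1 + \<gamma> / 2) * (norm ?a)\<^sup>2 + (1 + 1 / (\<gamma> / 2)) * (norm ?b)\<^sup>2"
          using norm_add_square_young[of "\<gamma> / 2" ?a ?b] gamma by simp
        then have "(1 - \<gamma>) * (norm (v (Suc t) \<omega> - gF (Suc t) \<omega>))\<^sup>2
            \<le> (1 - \<gamma>) * ((1 + \<gamma> / 2) * (norm ?a)\<^sup>2 + (1 + 1 / (\<gamma> / 2)) * (norm ?b)\<^sup>2)"
          using gamma by (intro mult_left_mono) auto
        also have "\<dots> = ((1 - \<gamma>) * (1 + \<gamma> / 2)) * (norm ?a)\<^sup>2 + ((1 - \<gamma>) * (1 + 1 / (\<gamma> / 2))) * (norm ?b)\<^sup>2"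
          by (subst distrib_left) (simp only: mult.assoc)
        also have "\<dots> \<le> (1 - \<gamma> / 2) * (norm ?a)\<^sup>2 + (2 / \<gamma>) * (norm ?b)\<^sup>2"
        proof (intro add_mono mult_right_mono)
          show "(1 - \<gamma>) * (1 + \<gamma> / 2) \<le> 1 - \<gamma> / 2"
            using gamma by (simp add: algebra_simps)
          show "(1 - \<gamma>) * (1 + 1 / (\<gamma> / 2)) \<le> 2 / \<gamma>"
            using gamma by (simp add: field_simps)
        qed auto
        finally show ?thesis .
      qed
      moreover have "(2 / \<gamma>) * (norm ?b)\<^sup>2 \<le> (2 / \<gamma>) * (Lh\<^sup>2 * (\<eta>\<^sub>x * c\<^sub>u)\<^sup>2 * (norm (v (Suc t) \<omega>))\<^sup>2)"
        using b gamma by (intro mult_left_mono) auto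
      moreover have "\<gamma> * (norm (gx (Suc t) \<omega> - gF (Suc t) \<omega>))\<^sup>2 \<le> \<gamma> * (L\<^sub>f\<^sup>2 * (norm (y (Suc t) \<omega> - p (Suc t) \<omega>))\<^sup>2)"
        using c gamma by (intro mult_left_mono) auto
      ultimately show "(norm (Z \<omega>))\<^sup>2 \<le> (1 - \<gamma> / 2) * (norm ?a)\<^sup>2
          + (2 / \<gamma>) * (Lh\<^sup>2 * (\<eta>\<^sub>x * c\<^sub>u)\<^sup>2 * (norm (v (Suc t) \<omega>))\<^sup>2)
          + \<gamma> * (L\<^sub>f\<^sup>2 * (norm (y (Suc t) \<omega> - p (Suc t) \<omega>))\<^sup>2)"
        by linarith
    qed
  qed
  also have "\<dots> = (1 - \<gamma> / 2) * EA t + (2 / \<gamma>) * (Lh\<^sup>2 * (\<eta>\<^sub>x * c\<^sub>u)\<^sup>2 * EB t) + \<gamma> * (L\<^sub>f\<^sup>2 * ED (Suc t))"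
    using square_integrableD(2)[OF momentum_error_square_integrable[OF t(1)]]
      square_integrableD(2)[OF square_integrable_iterates(2)[OF t(2)]]
      square_integrableD(2)[OF gap_square_integrable[OF t(2)]]
    by (simp add: EA_def EB_def ED_def)
  finally show ?thesis by (simp add: Lh_def)
qed

text \<open>The noiseless ascent step gains \<open>\<rho>\<close> from monotonicity and loses at
  most \<open>\<rho> / 4\<close> to the squared gradient difference. Exchanging the maximizer of
  \<open>x t\<close> for that of \<open>x (Suc t)\<close> costs another \<open>\<rho> / 4\<close>,
  which leaves the rate \<open>\<rho> / 2\<close>.\<close>

lemma dual_recursion:
  assumes t: "t \<le> T"
  defines "\<rho> \<equiv> \<eta>\<^sub>y * \<mu>"
  shows "ED (Suc t) \<le> (1 - \<rho> / 2) * ED t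
    + (2 * \<eta>\<^sub>y\<^sup>2 * \<sigma>\<^sup>2 + (20 / \<rho>) * ((L\<^sub>f / \<mu>)\<^sup>2 * (\<eta>\<^sub>x * c\<^sub>u)\<^sup>2 * EB t))"
proof -
  have t': "t \<le> Suc T" "Suc t \<le> Suc T" using t by auto
  have \<rho>: "0 < \<rho>" "\<rho> \<le> 1" using eta_y_pos mu_pos eta_y_small by (simp_all add: \<rho>_def)
  define k where "k = L\<^sub>f / \<mu>"
  have k0: "0 \<le> k" using L_nonneg mu_pos by (simp add: k_def)
  define gp where "gp \<omega> = grad_y (x t \<omega>) (p t \<omega>)" for \<omega>
  define Z where "Z \<omega> = (y t \<omega> - p t \<omega>) + \<eta>\<^sub>y *\<^sub>R (gy t \<omega> - gp \<omega>)" for \<omega>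
  have [measurable]: "y t \<in> borel_measurable (F t)" "p t \<in> borel_measurable (F t)"
    "gy t \<in> borel_measurable (F t)" "gp \<in> borel_measurable (F t)"
    using iterates_adapted[OF t'(1)] p_adapted[OF t'(1)] gy_adapted[OF t'(1)] gyp_adapted[OF t'(1)]
    by (auto simp: gp_def[abs_def])
  have Zm: "Z \<in> borel_measurable (F t)" unfolding Z_def by measurable
  note gap = gap_square_integrable[OF t'(1)]
  have Zle: "(norm (Z \<omega>))\<^sup>2 \<le> (1 - 3 * \<rho> / 4) * (norm (y t \<omega> - p t \<omega>))\<^sup>2" if \<omega>: "\<omega> \<in> space M" for \<omega>
  proof -
    note Yt = y_in_Y[OF t'(1) \<omega>]
    let ?d = "y t \<omega> - p t \<omega>" and ?g = "gy t \<omega> - gp \<omega>"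
    have mono: "?g \<bullet> ?d \<le> - (\<mu> / 2) * (norm ?d)\<^sup>2"
      unfolding gp_def by (rule grad_y_monotone[OF Yt])
    have "norm ?g \<le> L\<^sub>f * norm ?d"
      using grad_lipschitz_dist(2)[OF Yt ystar_in_Y, of "x t \<omega>" "x t \<omega>" "x t \<omega>" "y t \<omega>"]
      by (simp add: gp_def norm_Pair)
    then have lip: "(norm ?g)\<^sup>2 \<le> L\<^sub>f\<^sup>2 * (norm ?d)\<^sup>2"
      using power_mono[of "norm ?g" "L\<^sub>f * norm ?d" 2] by (simp add: power_mult_distrib)
    have "(norm (Z \<omega>))\<^sup>2 = (norm ?d)\<^sup>2 + 2 * \<eta>\<^sub>y * (?g \<bullet> ?d) + \<eta>\<^sub>y\<^sup>2 * (norm ?g)\<^sup>2"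
      unfolding Z_def power2_norm_eq_inner
      by (simp add: inner_add_left inner_add_right inner_commute power2_eq_square algebra_simps)
    also have "\<dots> \<le> (norm ?d)\<^sup>2 + 2 * \<eta>\<^sub>y * (- (\<mu> / 2) * (norm ?d)\<^sup>2) + \<eta>\<^sub>y\<^sup>2 * (L\<^sub>f\<^sup>2 * (norm ?d)\<^sup>2)"
      using mono lip eta_y_pos by (intro add_mono mult_left_mono) auto
    also have "\<dots> = (1 - \<rho> + \<eta>\<^sub>y * (\<eta>\<^sub>y * L\<^sub>f\<^sup>2)) * (norm ?d)\<^sup>2"
      by (simp add: \<rho>_def power2_eq_square algebra_simps)
    also have "\<dots> \<le> (1 - \<rho> + \<eta>\<^sub>y * (\<mu> / 4)) * (norm ?d)\<^sup>2"
      using eta_y_small eta_y_pos by (intro mult_right_mono add_left_mono mult_left_mono) auto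
    finally show ?thesis by (simp add: \<rho>_def algebra_simps)
  qed
  have Z2: "square_integrable M Z"
  proof (rule square_integrable_bound[OF gap measurable_F_M[OF Zm] AE_I2])
    fix \<omega> assume "\<omega> \<in> space M"
    have "(1 - 3 * \<rho> / 4) * (norm (y t \<omega> - p t \<omega>))\<^sup>2 \<le> 1 * (norm (y t \<omega> - p t \<omega>))\<^sup>2"
      using \<rho> by (intro mult_right_mono) auto
    with Zle[OF \<open>\<omega> \<in> space M\<close>] have "(norm (Z \<omega>))\<^sup>2 \<le> (norm (y t \<omega> - p t \<omega>))\<^sup>2" by linarith
    then show "norm (Z \<omega>) \<le> norm (y t \<omega> - p t \<omega>)"
      by (rule power2_le_imp_le) simp
  qed
  \<comment> \<open>\<open>W\<close> is the error before projection. The noise enters it linearly,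
    so orthogonality applies; the projection is dealt with afterwards by nonexpansiveness,
    pointwise.\<close>
  define W where "W \<omega> = Z \<omega> + \<eta>\<^sub>y *\<^sub>R (oy t \<omega> - gy t \<omega>)" for \<omega>
  have W2: "square_integrable M W"
    unfolding W_def
    by (intro square_integrable_add square_integrable_scaleR Z2
        cond_unbiased_variance(1)[OF Oy_unbiased[OF t] F_sub gy_adapted[OF t'(1)]])
  have W_dist: "norm (y (Suc t) \<omega> - p t \<omega>) \<le> norm (W \<omega>)" if \<omega>: "\<omega> \<in> space M" for \<omega>
  proof -
    have "p t \<omega> = closest_point Y (p t \<omega> + \<eta>\<^sub>y *\<^sub>R gp \<omega>)"
      unfolding gp_def using eta_y_pos by (intro maximizer_fixpoint[OF ystar_maximizer, symmetric]) simp
    then have "dist (y (Suc t) \<omega>) (p t \<omega>) \<le> dist (y t \<omega> + \<eta>\<^sub>y *\<^sub>R oy t \<omega>) (p t \<omega> + \<eta>\<^sub>y *\<^sub>R gp \<omega>)"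
      using closest_point_lipschitz[OF convex_Y closed_Y, of "y t \<omega> + \<eta>\<^sub>y *\<^sub>R oy t \<omega>" "p t \<omega> + \<eta>\<^sub>y *\<^sub>R gp \<omega>"]
        y0_in_Y y_step[OF t \<omega>] by auto
    then show ?thesis by (simp add: dist_norm W_def Z_def algebra_simps)
  qed
  have "ED (Suc t) \<le> (\<integral>\<omega>. (1 + \<rho> / 4) * (norm (W \<omega>))\<^sup>2
      + (20 / \<rho>) * (k\<^sup>2 * (\<eta>\<^sub>x * c\<^sub>u)\<^sup>2 * (norm (v (Suc t) \<omega>))\<^sup>2) \<partial>M)"
    unfolding ED_def
  proof (rule integral_mono_AE)
    show "integrable M (\<lambda>\<omega>. (norm (y (Suc t) \<omega> - p (Suc t) \<omega>))\<^sup>2)"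
      by (intro square_integrableD gap_square_integrable t')
    show "integrable M (\<lambda>\<omega>. (1 + \<rho> / 4) * (norm (W \<omega>))\<^sup>2
      + (20 / \<rho>) * (k\<^sup>2 * (\<eta>\<^sub>x * c\<^sub>u)\<^sup>2 * (norm (v (Suc t) \<omega>))\<^sup>2))"
      by (intro Bochner_Integration.integrable_add integrable_mult_right square_integrableD
          W2 square_integrable_iterates t')
    show "AE \<omega> in M. (norm (y (Suc t) \<omega> - p (Suc t) \<omega>))\<^sup>2 \<le> (1 + \<rho> / 4) * (norm (W \<omega>))\<^sup>2
      + (20 / \<rho>) * (k\<^sup>2 * (\<eta>\<^sub>x * c\<^sub>u)\<^sup>2 * (norm (v (Suc t) \<omega>))\<^sup>2)"
      using x_step_bound[OF t]
    proof (rule AE_mp, intro AE_I2 impI)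
      fix \<omega> assume \<omega>: "\<omega> \<in> space M" and step: "norm (x (Suc t) \<omega> - x t \<omega>) \<le> \<eta>\<^sub>x * c\<^sub>u * norm (v (Suc t) \<omega>)"
      let ?b = "2 * k * (\<eta>\<^sub>x * c\<^sub>u * norm (v (Suc t) \<omega>))"
      have "norm (y (Suc t) \<omega> - p (Suc t) \<omega>) \<le> norm (W \<omega>) + 2 * k * norm (x (Suc t) \<omega> - x t \<omega>)"
        using ystar_drift[of "y (Suc t) \<omega>" "x (Suc t) \<omega>" "x t \<omega>" "y t \<omega>"] W_dist[OF \<omega>] by (simp add: k_def)
      also have "\<dots> \<le> norm (W \<omega>) + ?b"
        using step k0 by (intro add_left_mono mult_left_mono) auto
      finally have "(norm (y (Suc t) \<omega> - p (Suc t) \<omega>))\<^sup>2 \<le> (norm (norm (W \<omega>) + ?b))\<^sup>2"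
        by (intro power_mono) auto
      \<comment> \<open>With parameter \<open>\<rho> / 4\<close> the drift gets the factor
        \<open>1 + 4 / \<rho> \<le> 5 / \<rho>\<close>; the square of the 2 in the drift constant
        raises 5 to 20.\<close>
      also have "\<dots> \<le> (1 + \<rho> / 4) * (norm (norm (W \<omega>)))\<^sup>2 + (1 + 1 / (\<rho> / 4)) * (norm ?b)\<^sup>2"
        using \<rho> by (intro norm_add_square_young) auto
      also have "(1 + 1 / (\<rho> / 4)) * (norm ?b)\<^sup>2 \<le> (5 / \<rho>) * (norm ?b)\<^sup>2"
        using \<rho> by (intro mult_right_mono) (auto simp: field_simps)
      also have "(5 / \<rho>) * (norm ?b)\<^sup>2 = (20 / \<rho>) * (k\<^sup>2 * (\<eta>\<^sub>x * c\<^sub>u)\<^sup>2 * (norm (v (Suc t) \<omega>))\<^sup>2)"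
        by (simp add: power_mult_distrib)
      finally show "(norm (y (Suc t) \<omega> - p (Suc t) \<omega>))\<^sup>2 \<le> (1 + \<rho> / 4) * (norm (W \<omega>))\<^sup>2
          + (20 / \<rho>) * (k\<^sup>2 * (\<eta>\<^sub>x * c\<^sub>u)\<^sup>2 * (norm (v (Suc t) \<omega>))\<^sup>2)"
        by simp
    qed
  qed
  also have "\<dots> = (1 + \<rho> / 4) * (\<integral>\<omega>. (norm (W \<omega>))\<^sup>2 \<partial>M) + (20 / \<rho>) * (k\<^sup>2 * (\<eta>\<^sub>x * c\<^sub>u)\<^sup>2 * EB t)"
    using square_integrableD(2)[OF W2] square_integrableD(2)[OF square_integrable_iterates(2)[OF t'(2)]]
    by (simp add: EB_def)
  also have "(\<integral>\<omega>. (norm (W \<omega>))\<^sup>2 \<partial>M) \<le> (\<integral>\<omega>. (norm (Z \<omega>))\<^sup>2 \<partial>M) + \<eta>\<^sub>y\<^sup>2 * \<sigma>\<^sup>2"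
    unfolding W_def
    by (rule cond_unbiased_second_moment[OF Oy_unbiased[OF t] F_sub gy_adapted[OF t'(1)] Zm Z2])
  also have "(\<integral>\<omega>. (norm (Z \<omega>))\<^sup>2 \<partial>M) \<le> (\<integral>\<omega>. (1 - 3 * \<rho> / 4) * (norm (y t \<omega> - p t \<omega>))\<^sup>2 \<partial>M)"
    by (intro integral_mono_AE square_integrableD Z2 integrable_mult_right gap AE_I2 Zle)
  also have "\<dots> = (1 - 3 * \<rho> / 4) * ED t" by (simp add: ED_def)
  also have "(1 + \<rho> / 4) * ((1 - 3 * \<rho> / 4) * ED t + \<eta>\<^sub>y\<^sup>2 * \<sigma>\<^sup>2)
      \<le> (1 - \<rho> / 2) * ED t + 2 * (\<eta>\<^sub>y\<^sup>2 * \<sigma>\<^sup>2)"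
  proof -
    have "((1 + \<rho> / 4) * (1 - 3 * \<rho> / 4)) * ED t \<le> (1 - \<rho> / 2) * ED t"
      using ED_nonneg by (intro mult_right_mono) (simp_all add: algebra_simps)
    moreover have "(1 + \<rho> / 4) * (\<eta>\<^sub>y\<^sup>2 * \<sigma>\<^sup>2) \<le> 2 * (\<eta>\<^sub>y\<^sup>2 * \<sigma>\<^sup>2)"
      using \<rho> by (intro mult_right_mono) auto
    ultimately show ?thesis by (simp add: distrib_left mult.assoc)
  qed
  finally show ?thesis using \<rho> by (simp add: k_def mult.assoc)
qed

text \<open>The values of the primal function telescope along each path and are bounded by
  \<open>\<Delta>\<close> before integration, so only squared norms have to be integrated.\<close>

lemma descent_sum:
  assumes lower: "\<And>z. primal_function f Y x\<^sub>0 - primal_function f Y z \<le> \<Delta>"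
  shows "\<eta>\<^sub>x * c\<^sub>l / 2 * (\<Sum>t\<le>T. EG t) + \<eta>\<^sub>x * c\<^sub>l / 4 * (\<Sum>t\<le>T. EB t) \<le> \<Delta> + \<eta>\<^sub>x * c\<^sub>u / 2 * (\<Sum>t\<le>T. EA t)"
proof -
  let ?P = "primal_function f Y"
  let ?l = "\<lambda>t \<omega>. \<eta>\<^sub>x * c\<^sub>l / 2 * (norm (gF t \<omega>))\<^sup>2 + \<eta>\<^sub>x * c\<^sub>l / 4 * (norm (v (Suc t) \<omega>))\<^sup>2"
  let ?r = "\<lambda>t \<omega>. \<eta>\<^sub>x * c\<^sub>u / 2 * (norm (v (Suc t) \<omega> - gF t \<omega>))\<^sup>2"
  have l: "integrable M (?l t)" and r: "integrable M (?r t)" if "t \<le> T" for t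
    using that by (intro Bochner_Integration.integrable_add integrable_mult_right square_integrableD
        gF_square_integrable square_integrable_iterates momentum_error_square_integrable; simp)+
  have "AE \<omega> in M. \<forall>t\<in>{..T}. ?l t \<omega> \<le> ?P (x t \<omega>) - ?P (x (Suc t) \<omega>) + ?r t \<omega>"
    by (intro AE_finite_allI descent_AE) auto
  then have path: "AE \<omega> in M. (\<Sum>t\<le>T. ?l t \<omega>) \<le> \<Delta> + (\<Sum>t\<le>T. ?r t \<omega>)"
  proof (rule AE_mp, intro AE_I2 impI)
    fix \<omega> assume \<omega>: "\<omega> \<in> space M"
      and le: "\<forall>t\<in>{..T}. ?l t \<omega> \<le> ?P (x t \<omega>) - ?P (x (Suc t) \<omega>) + ?r t \<omega>"
    have "(\<Sum>t\<le>T. ?l t \<omega>) \<le> (\<Sum>t\<le>T. ?P (x t \<omega>) - ?P (x (Suc t) \<omega>) + ?r t \<omega>)"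
      using le by (intro sum_mono) auto
    also have "\<dots> = ?P (x 0 \<omega>) - ?P (x (Suc T) \<omega>) + (\<Sum>t\<le>T. ?r t \<omega>)"
      by (simp only: sum.distrib sum_telescope[of "\<lambda>t. ?P (x t \<omega>)"])
    also have "\<dots> \<le> \<Delta> + (\<Sum>t\<le>T. ?r t \<omega>)"
      using lower[of "x (Suc T) \<omega>"] init[OF \<omega>] by simp
    finally show "(\<Sum>t\<le>T. ?l t \<omega>) \<le> \<Delta> + (\<Sum>t\<le>T. ?r t \<omega>)" .
  qed
  have "(\<integral>\<omega>. (\<Sum>t\<le>T. ?l t \<omega>) \<partial>M) \<le> (\<integral>\<omega>. \<Delta> + (\<Sum>t\<le>T. ?r t \<omega>) \<partial>M)"
    by (rule integral_mono_AE[OF _ _ path])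
      (intro Bochner_Integration.integrable_add Bochner_Integration.integrable_sum l r; simp)+
  also have "\<dots> = \<Delta> + (\<Sum>t\<le>T. \<integral>\<omega>. ?r t \<omega> \<partial>M)"
    using r by (subst Bochner_Integration.integral_add) (auto simp: Bochner_Integration.integral_sum prob_space)
  also have "(\<Sum>t\<le>T. \<integral>\<omega>. ?r t \<omega> \<partial>M) = \<eta>\<^sub>x * c\<^sub>u / 2 * (\<Sum>t\<le>T. EA t)"
    by (simp add: EA_def sum_distrib_left)
  finally have main: "(\<integral>\<omega>. (\<Sum>t\<le>T. ?l t \<omega>) \<partial>M) \<le> \<Delta> + \<eta>\<^sub>x * c\<^sub>u / 2 * (\<Sum>t\<le>T. EA t)" .
  have "(\<integral>\<omega>. (\<Sum>t\<le>T. ?l t \<omega>) \<partial>M) = (\<Sum>t\<le>T. \<integral>\<omega>. ?l t \<omega> \<partial>M)"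
    using l by (intro Bochner_Integration.integral_sum) auto
  also have "\<dots> = (\<Sum>t\<le>T. \<eta>\<^sub>x * c\<^sub>l / 2 * EG t + \<eta>\<^sub>x * c\<^sub>l / 4 * EB t)"
  proof (rule sum.cong[OF refl])
    fix t assume "t \<in> {..T}"
    then have t: "t \<le> Suc T" "Suc t \<le> Suc T" by auto
    show "(\<integral>\<omega>. ?l t \<omega> \<partial>M) = \<eta>\<^sub>x * c\<^sub>l / 2 * EG t + \<eta>\<^sub>x * c\<^sub>l / 4 * EB t"
      using square_integrableD(2)[OF gF_square_integrable[OF t(1)]]
        square_integrableD(2)[OF square_integrable_iterates(2)[OF t(2)]]
      by (simp add: EG_def EB_def)
  qed
  also have "\<dots> = \<eta>\<^sub>x * c\<^sub>l / 2 * (\<Sum>t\<le>T. EG t) + \<eta>\<^sub>x * c\<^sub>l / 4 * (\<Sum>t\<le>T. EB t)"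
    by (simp add: sum.distrib sum_distrib_left)
  finally show ?thesis using main by simp
qed

end

subsection \<open>Rates\<close>

text \<open>Here \<open>w\<close> and \<open>n\<close> stand for the square roots of \<open>\<kappa>\<close> and \<open>T\<close>, and \<open>SA\<close>, \<open>SB\<close>, \<open>SD\<close>, \<open>SG\<close> for the
  sums over the run of \<open>A\<close>, \<open>B\<close>, \<open>D\<close> and of the expected squared norm of the gradient.\<close>

lemma pdsm_constants:
  fixes w n \<mu> L K s c\<^sub>l c\<^sub>u \<kappa>\<^sub>0 \<Delta> D\<^sub>v D\<^sub>y \<sigma> SA SB SD SG :: real
  assumes pos: "0 < w" "0 < n" "0 < \<mu>" "0 < s" "0 < c\<^sub>l" "c\<^sub>l \<le> c\<^sub>u" "0 < \<kappa>\<^sub>0" "\<kappa>\<^sub>0 \<le> w\<^sup>2"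
    and nonneg: "0 \<le> D\<^sub>v" "0 \<le> D\<^sub>y" "0 \<le> SB" "0 \<le> SG" "0 \<le> \<Delta>"
    and L: "L = w\<^sup>2 * \<mu>" and K: "K = 1 + 1 / \<kappa>\<^sub>0"
    and s: "s\<^sup>2 * c\<^sub>u\<^sup>2 = c\<^sub>l / c\<^sub>u / (2 ^ 14 + 64 * K ^ 4 * L\<^sup>2)"
    and A: "(w / n) / 2 * SA \<le> D\<^sub>v + ((2 / (w / n)) * ((L * (1 + 2 * w\<^sup>2))\<^sup>2 * (s / (w ^ 3 * n) * c\<^sub>u)\<^sup>2 * SB)
        + (w / n) * (L\<^sup>2 * SD) + (w / n)\<^sup>2 * \<sigma>\<^sup>2 * n\<^sup>2)"
    and D: "(w / n * \<mu>) / 2 * SD \<le> D\<^sub>y + (2 * (w / n)\<^sup>2 * \<sigma>\<^sup>2 * n\<^sup>2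
        + (20 / (w / n * \<mu>)) * ((w\<^sup>2)\<^sup>2 * (s / (w ^ 3 * n) * c\<^sub>u)\<^sup>2 * SB))"
    and G: "(s / (w ^ 3 * n)) * c\<^sub>l / 2 * SG + (s / (w ^ 3 * n)) * c\<^sub>l / 4 * SB \<le> \<Delta> + (s / (w ^ 3 * n)) * c\<^sub>u / 2 * SA"
  defines "C \<equiv> 16 * (c\<^sub>u / c\<^sub>l) * (64 * (K\<^sup>2 * D\<^sub>v + K * \<sigma>\<^sup>2 + K * L * D\<^sub>y + L * \<sigma>\<^sup>2) + \<Delta> / (c\<^sub>u * s))"
  shows "SG \<le> C * (w ^ 3 * n)" "2 * SA + 3 * (L\<^sup>2 * SD) \<le> C * (w ^ 3 * n)" "0 \<le> C"
proof -
  define N where "N = w ^ 3 * n"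
  define r where "r = c\<^sub>l / c\<^sub>u"
  \<comment> \<open>The square of the part of \<open>\<eta>\<^sub>x * c\<^sub>u\<close> that is free
    of \<open>w\<close> and \<open>n\<close>; every drift contribution is a multiple of
    \<open>q * SB\<close>.\<close>
  define q where "q = s\<^sup>2 * c\<^sub>u\<^sup>2"
  define W where "W = K\<^sup>2 * D\<^sub>v + K * \<sigma>\<^sup>2 + K * L * D\<^sub>y + L * \<sigma>\<^sup>2"
  define Z where "Z = \<Delta> / (c\<^sub>u * s)"
  have cu: "0 < c\<^sub>u" using pos by simp
  have N0: "0 < N" using pos by (simp add: N_def)
  have L0: "0 < L" using pos by (simp add: L)
  have r0: "0 < r" "r \<le> 1" using pos cu by (simp_all add: r_def)
  have K1: "1 \<le> K" using pos by (simp add: K)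
  have invw: "1 / w\<^sup>2 \<le> K - 1" using pos by (simp add: K frac_le)
  \<comment> \<open>The lower bound \<open>\<kappa>\<^sub>0\<close> on the condition number acts
    here: with the factor \<open>K\<close>, lower powers of \<open>w\<close> can be raised to the
    common \<open>w ^ 3\<close>.\<close>
  have K2: "1 \<le> K * w\<^sup>2"
  proof -
    have "1 / w\<^sup>2 \<le> K" using invw by simp
    then show ?thesis using pos by (simp add: field_simps)
  qed
  have w_le: "w \<le> K * w ^ 3"
    using mult_left_mono[OF K2, of w] pos by (simp add: power3_eq_cube power2_eq_square algebra_simps)
  have invw_le: "1 / w \<le> K\<^sup>2 * w ^ 3"
  proof -
    have "1 * 1 \<le> (K * w\<^sup>2) * (K * w\<^sup>2)" using K2 by (intro mult_mono) auto
    then have "1 \<le> (K\<^sup>2 * w ^ 3) * w" by (simp add: power2_eq_square power3_eq_cube algebra_simps)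
    then show ?thesis using pos by (simp add: divide_le_eq)
  qed
  \<comment> \<open>Source of \<open>K ^ 4\<close> in the step constant: it bounds the squared
    Lipschitz factor of \<open>grad_F\<close> after division by the powers of \<open>w\<close> from
    the step sizes.\<close>
  have lip: "(1 + 2 * w\<^sup>2)\<^sup>2 / w ^ 8 \<le> K ^ 4"
  proof -
    have "(1 + 2 * w\<^sup>2) / w ^ 4 = 1 / w\<^sup>2 * (1 / w\<^sup>2 + 2)"
      using pos by (simp add: field_simps power2_eq_square eval_nat_numeral)
    also have "\<dots> \<le> (K - 1) * (K - 1 + 2)"
      using invw K1 pos by (intro mult_mono add_right_mono) auto
    also have "\<dots> \<le> K\<^sup>2" by (simp add: power2_eq_square algebra_simps)
    finally have "((1 + 2 * w\<^sup>2) / w ^ 4)\<^sup>2 \<le> (K\<^sup>2)\<^sup>2" using pos by (intro power_mono) auto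
    then show ?thesis by (simp add: power_divide flip: power_mult)
  qed
  have D': "L\<^sup>2 * SD \<le> 2 * L * w * n * D\<^sub>y + 4 * L * w ^ 3 * n * \<sigma>\<^sup>2 + 40 * q * SB"
  proof -
    \<comment> \<open>The multiplier is \<open>L^2\<close> over the contraction rate
      \<open>w / n * \<mu> / 2\<close>, simplified with \<open>L = w^2 * \<mu>\<close>.\<close>
    have "L\<^sup>2 * SD = (2 * L * w * n) * ((w / n * \<mu>) / 2 * SD)"
      using pos by (simp add: L field_simps power2_eq_square)
    also have "\<dots> \<le> (2 * L * w * n) * (D\<^sub>y + (2 * (w / n)\<^sup>2 * \<sigma>\<^sup>2 * n\<^sup>2
        + (20 / (w / n * \<mu>)) * ((w\<^sup>2)\<^sup>2 * (s / (w ^ 3 * n) * c\<^sub>u)\<^sup>2 * SB)))"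
      using D L0 pos by (intro mult_left_mono) auto
    also have "\<dots> = 2 * L * w * n * D\<^sub>y + 4 * L * w ^ 3 * n * \<sigma>\<^sup>2 + 40 * q * SB"
      using pos by (simp add: L q_def field_simps eval_nat_numeral)
    finally show ?thesis .
  qed
  have A': "SA \<le> 2 * n * (1 / w) * D\<^sub>v + 4 * L\<^sup>2 * ((1 + 2 * w\<^sup>2)\<^sup>2 / w ^ 8) * q * SB + 2 * (L\<^sup>2 * SD) + 2 * w * n * \<sigma>\<^sup>2"
  proof -
    have "SA = (2 * n / w) * ((w / n) / 2 * SA)"
      using pos by (simp add: field_simps)
    also have "\<dots> \<le> (2 * n / w) * (D\<^sub>v + ((2 / (w / n)) * ((L * (1 + 2 * w\<^sup>2))\<^sup>2 * (s / (w ^ 3 * n) * c\<^sub>u)\<^sup>2 * SB)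
        + (w / n) * (L\<^sup>2 * SD) + (w / n)\<^sup>2 * \<sigma>\<^sup>2 * n\<^sup>2))"
      using A pos by (intro mult_left_mono) auto
    also have "\<dots> = (2 * n / w) * D\<^sub>v + (2 * n / w) * ((2 / (w / n)) * ((L * (1 + 2 * w\<^sup>2))\<^sup>2 * (s / (w ^ 3 * n) * c\<^sub>u)\<^sup>2 * SB))
        + (2 * n / w) * ((w / n) * (L\<^sup>2 * SD)) + (2 * n / w) * ((w / n)\<^sup>2 * \<sigma>\<^sup>2 * n\<^sup>2)"
      by (simp only: distrib_left add.assoc)
    also have "(2 * n / w) * ((2 / (w / n)) * ((L * (1 + 2 * w\<^sup>2))\<^sup>2 * (s / (w ^ 3 * n) * c\<^sub>u)\<^sup>2 * SB))
        = 4 * L\<^sup>2 * ((1 + 2 * w\<^sup>2)\<^sup>2 / w ^ 8) * q * SB"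
      using pos by (simp add: q_def power_mult_distrib power_divide) (simp add: field_simps eval_nat_numeral)
    also have "(2 * n / w) * ((w / n) * (L\<^sup>2 * SD)) = 2 * (L\<^sup>2 * SD)"
      using pos by simp
    also have "(2 * n / w) * ((w / n)\<^sup>2 * \<sigma>\<^sup>2 * n\<^sup>2) = 2 * w * n * \<sigma>\<^sup>2"
      using pos by (simp add: power2_eq_square)
    finally show ?thesis by simp
  qed
  have q0: "0 \<le> q" by (simp add: q_def)
  have den: "0 < 2 ^ 14 + 64 * K ^ 4 * L\<^sup>2"
    by (intro add_pos_nonneg) auto
  have q_eq: "q * (2 ^ 14 + 64 * K ^ 4 * L\<^sup>2) = r"
    using den by (simp add: q_def s r_def)
  define m where "m = q * (K ^ 4 * L\<^sup>2)"
  have m: "0 \<le> m" "16384 * q + 64 * m = r" "(80 + 4 * K ^ 4 * L\<^sup>2) * q = 80 * q + 4 * m"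
    using q0 q_eq by (simp_all add: m_def algebra_simps)
  \<comment> \<open>The coefficients of \<open>SB\<close>: 80 is twice the 40 of the dual bound,
    \<open>4 * K ^ 4 * L^2\<close> is the momentum drift, and 120 is three times 40. The numbers
    \<open>2 ^ 14\<close> and 64 in the step constant keep both below a quarter of
    \<open>r\<close>.\<close>
  have q1: "(80 + 4 * K ^ 4 * L\<^sup>2) * q \<le> r / 4" and q2: "120 * q \<le> r / 4"
    using q0 m by linarith+
  have DL: "L\<^sup>2 * SD \<le> N * (2 * (K * L * D\<^sub>y) + 4 * (L * \<sigma>\<^sup>2)) + 40 * q * SB"
  proof -
    have "(2 * L * n * D\<^sub>y) * w \<le> (2 * L * n * D\<^sub>y) * (K * w ^ 3)"
      using w_le L0 pos nonneg by (intro mult_left_mono) auto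
    then show ?thesis using D' by (simp add: N_def algebra_simps)
  qed
  have SA_le: "SA \<le> N * (2 * (K\<^sup>2 * D\<^sub>v) + 2 * (K * \<sigma>\<^sup>2)) + 4 * K ^ 4 * L\<^sup>2 * q * SB + 2 * (L\<^sup>2 * SD)"
  proof -
    have "(2 * n * D\<^sub>v) * (1 / w) \<le> (2 * n * D\<^sub>v) * (K\<^sup>2 * w ^ 3)"
      using invw_le pos nonneg by (intro mult_left_mono) auto
    moreover have "(2 * n * \<sigma>\<^sup>2) * w \<le> (2 * n * \<sigma>\<^sup>2) * (K * w ^ 3)"
      using w_le pos by (intro mult_left_mono) auto
    moreover have "(4 * L\<^sup>2 * q * SB) * ((1 + 2 * w\<^sup>2)\<^sup>2 / w ^ 8) \<le> (4 * L\<^sup>2 * q * SB) * K ^ 4"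
      using lip q0 nonneg by (intro mult_left_mono) auto
    ultimately show ?thesis using A' by (simp add: N_def algebra_simps)
  qed
  have W0: "0 \<le> K\<^sup>2 * D\<^sub>v" "0 \<le> K * \<sigma>\<^sup>2" "0 \<le> K * L * D\<^sub>y" "0 \<le> L * \<sigma>\<^sup>2"
    using K1 L0 nonneg by auto
  have WN: "0 \<le> W" using W0 by (simp add: W_def)
  have Z0: "0 \<le> Z" using nonneg cu pos by (simp add: Z_def)
  have SA_bound: "SA \<le> N * (8 * W) + r / 4 * SB"
  proof -
    have "SA \<le> N * (2 * (K\<^sup>2 * D\<^sub>v) + 2 * (K * \<sigma>\<^sup>2) + 4 * (K * L * D\<^sub>y) + 8 * (L * \<sigma>\<^sup>2)) + ((80 + 4 * K ^ 4 * L\<^sup>2) * q) * SB"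
      using SA_le DL by (simp add: algebra_simps)
    also have "\<dots> \<le> N * (8 * W) + r / 4 * SB"
    proof (intro add_mono mult_left_mono mult_right_mono q1)
      show "2 * (K\<^sup>2 * D\<^sub>v) + 2 * (K * \<sigma>\<^sup>2) + 4 * (K * L * D\<^sub>y) + 8 * (L * \<sigma>\<^sup>2) \<le> 8 * W"
        using W0 unfolding W_def distrib_left by linarith
    qed (use N0 nonneg in auto)
    finally show ?thesis .
  qed
  have D_bound: "L\<^sup>2 * SD \<le> N * (4 * W) + 40 * q * SB"
  proof -
    have "N * (2 * (K * L * D\<^sub>y) + 4 * (L * \<sigma>\<^sup>2)) \<le> N * (4 * W)"
    proof (intro mult_left_mono)
      show "2 * (K * L * D\<^sub>y) + 4 * (L * \<sigma>\<^sup>2) \<le> 4 * W"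
        using W0 unfolding W_def distrib_left by linarith
    qed (use N0 in simp)
    then show ?thesis using DL by linarith
  qed
  have G': "r * (SG + SB / 2) \<le> N * (2 * Z) + SA"
  proof -
    \<comment> \<open>The multiplier normalizes the coefficient of \<open>SA\<close> in the descent
      inequality to 1.\<close>
    have "r * (SG + SB / 2) = (2 * N / (s * c\<^sub>u)) * ((s / (w ^ 3 * n)) * c\<^sub>l / 2 * SG + (s / (w ^ 3 * n)) * c\<^sub>l / 4 * SB)"
      using pos cu N0 unfolding r_def N_def[symmetric] by (simp add: field_simps)
    also have "\<dots> \<le> (2 * N / (s * c\<^sub>u)) * (\<Delta> + (s / (w ^ 3 * n)) * c\<^sub>u / 2 * SA)"
      using G pos cu N0 by (intro mult_left_mono) auto
    also have "\<dots> = N * (2 * Z) + SA"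
      using pos cu N0 unfolding Z_def N_def[symmetric] by (simp add: field_simps)
    finally show ?thesis .
  qed
  \<comment> \<open>Half of the available \<open>r * SB / 2\<close> absorbs the drift inside
    \<open>SA\<close>. The remaining quarter also bounds \<open>SB\<close> itself, as the second
    estimate requires.\<close>
  then have GB: "r * SG + r * SB / 4 \<le> N * (2 * Z + 8 * W)"
    using SA_bound by (simp add: algebra_simps)
  have C_eq: "C = 16 * (64 * W + Z) / r"
    by (simp add: C_def W_def Z_def r_def)
  show C0: "0 \<le> C" using WN Z0 r0 by (simp add: C_eq)
  have "r * SG \<le> N * (2 * Z + 8 * W)"
    using GB r0 nonneg by (smt (verit) divide_nonneg_nonneg mult_nonneg_nonneg)
  also have "\<dots> \<le> N * (16 * (64 * W + Z))"
    using WN Z0 N0 by (intro mult_left_mono) auto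
  finally show "SG \<le> C * (w ^ 3 * n)"
    using r0 unfolding C_eq N_def[symmetric] by (simp add: field_simps)
  have "r * SB / 4 \<le> N * (2 * Z + 8 * W)"
    using GB r0 nonneg by (smt (verit) mult_nonneg_nonneg)
  moreover have "120 * q * SB \<le> r / 4 * SB"
    using q2 nonneg by (intro mult_right_mono) auto
  moreover have "0 \<le> N * W" "0 \<le> N * Z" using N0 WN Z0 by simp_all
  \<comment> \<open>The left side carries at most \<open>r / 2 + r / 4\<close> times
    \<open>SB\<close>, three times the quantity just bounded. Altogether this gives
    \<open>N * (52 * W + 6 * Z)\<close>, well within the constant.\<close>
  ultimately have "2 * SA + 3 * (L\<^sup>2 * SD) \<le> N * (16 * (64 * W + Z))"
    using SA_bound D_bound by (simp add: algebra_simps)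
  also have "\<dots> \<le> C * N"
  proof -
    have "16 * (64 * W + Z) * 1 \<le> 16 * (64 * W + Z) * (1 / r)"
      using r0 WN Z0 by (intro mult_left_mono) auto
    then have "16 * (64 * W + Z) \<le> C" by (simp add: C_eq)
    then show ?thesis
      unfolding mult.commute[of N] using N0 by (intro mult_right_mono) auto
  qed
  finally show "2 * SA + 3 * (L\<^sup>2 * SD) \<le> C * (w ^ 3 * n)" by (simp add: N_def)
qed


lemma powr_three_halves: "0 \<le> a \<Longrightarrow> a powr (3 / 2) = sqrt a ^ 3"
  by (cases "a = 0") (simp_all add: powr_half_sqrt[symmetric] powr_powr flip: powr_realpow)

section \<open>Summed errors, averages and initial values\<close>

context pdsm_analysis
begin

text \<open>The bias involves the dual error at the later index; as the recursion runs only for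
  \<open>t < T\<close>, the shifted indices stay within the sum up to \<open>T\<close>.\<close>

lemma momentum_error_sum:
  "\<gamma> / 2 * (\<Sum>t\<le>T. EA t) \<le> EA 0
    + ((2 / \<gamma>) * ((L\<^sub>f * (1 + 2 * (L\<^sub>f / \<mu>)))\<^sup>2 * (\<eta>\<^sub>x * c\<^sub>u)\<^sup>2 * (\<Sum>t\<le>T. EB t))
      + \<gamma> * (L\<^sub>f\<^sup>2 * (\<Sum>t\<le>T. ED t)) + \<gamma>\<^sup>2 * \<sigma>\<^sup>2 * real T)"
proof -
  let ?c = "(2 / \<gamma>) * ((L\<^sub>f * (1 + 2 * (L\<^sub>f / \<mu>)))\<^sup>2 * (\<eta>\<^sub>x * c\<^sub>u)\<^sup>2)"
  have "\<gamma> / 2 * (\<Sum>t\<le>T. EA t)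
      \<le> EA 0 + (\<Sum>t<T. ?c * EB t + \<gamma> * L\<^sub>f\<^sup>2 * ED (Suc t) + \<gamma>\<^sup>2 * \<sigma>\<^sup>2)"
    using momentum_recursion gamma
    by (intro sum_le_of_contraction EA_nonneg) (auto simp: Suc_le_eq mult.assoc)
  also have "\<dots> = EA 0 + (?c * (\<Sum>t<T. EB t) + \<gamma> * L\<^sub>f\<^sup>2 * (\<Sum>t<T. ED (Suc t)) + \<gamma>\<^sup>2 * \<sigma>\<^sup>2 * real T)"
    by (simp add: sum.distrib sum_distrib_left)
  also have "\<dots> \<le> EA 0 + (?c * (\<Sum>t\<le>T. EB t) + \<gamma> * L\<^sub>f\<^sup>2 * (\<Sum>t\<le>T. ED t) + \<gamma>\<^sup>2 * \<sigma>\<^sup>2 * real T)"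
  proof (intro add_left_mono add_right_mono add_mono mult_left_mono)
    show "(\<Sum>t<T. EB t) \<le> (\<Sum>t\<le>T. EB t)"
      by (intro sum_mono2) (auto simp: EB_nonneg)
    show "(\<Sum>t<T. ED (Suc t)) \<le> (\<Sum>t\<le>T. ED t)"
      using ED_nonneg[of 0] by (simp add: sum.atMost_shift)
  qed (use gamma in auto)
  finally show ?thesis by (simp add: mult.assoc)
qed

lemma dual_error_sum:
  "\<eta>\<^sub>y * \<mu> / 2 * (\<Sum>t\<le>T. ED t) \<le> ED 0
    + (2 * \<eta>\<^sub>y\<^sup>2 * \<sigma>\<^sup>2 * real T
      + (20 / (\<eta>\<^sub>y * \<mu>)) * ((L\<^sub>f / \<mu>)\<^sup>2 * (\<eta>\<^sub>x * c\<^sub>u)\<^sup>2 * (\<Sum>t\<le>T. EB t)))"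
proof -
  let ?c = "(20 / (\<eta>\<^sub>y * \<mu>)) * ((L\<^sub>f / \<mu>)\<^sup>2 * (\<eta>\<^sub>x * c\<^sub>u)\<^sup>2)"
  have "\<eta>\<^sub>y * \<mu> / 2 * (\<Sum>t\<le>T. ED t) \<le> ED 0 + (\<Sum>t<T. 2 * \<eta>\<^sub>y\<^sup>2 * \<sigma>\<^sup>2 + ?c * EB t)"
    using dual_recursion eta_y_small
    by (intro sum_le_of_contraction ED_nonneg) (auto simp: mult.assoc)
  also have "\<dots> = ED 0 + (2 * \<eta>\<^sub>y\<^sup>2 * \<sigma>\<^sup>2 * real T + ?c * (\<Sum>t<T. EB t))"
    by (simp add: sum.distrib sum_distrib_left)
  also have "\<dots> \<le> ED 0 + (2 * \<eta>\<^sub>y\<^sup>2 * \<sigma>\<^sup>2 * real T + ?c * (\<Sum>t\<le>T. EB t))"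
  proof (intro add_left_mono mult_left_mono)
    show "(\<Sum>t<T. EB t) \<le> (\<Sum>t\<le>T. EB t)"
      by (intro sum_mono2) (auto simp: EB_nonneg)
  qed (use eta_y_pos mu_pos in auto)
  finally show ?thesis by (simp add: mult.assoc)
qed

lemma gradient_average:
  "integrable M (\<lambda>\<omega>. 1 / (real T + 1) * (\<Sum>t=0..T. (norm (gF t \<omega>))\<^sup>2))"
  "(\<integral>\<omega>. 1 / (real T + 1) * (\<Sum>t=0..T. (norm (gF t \<omega>))\<^sup>2) \<partial>M) = (\<Sum>t\<le>T. EG t) / (real T + 1)"
proof -
  have int: "integrable M (\<lambda>\<omega>. (norm (gF t \<omega>))\<^sup>2)" if "t \<in> {0..T}" for t
    using that by (intro square_integrableD gF_square_integrable) simp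
  then show "integrable M (\<lambda>\<omega>. 1 / (real T + 1) * (\<Sum>t=0..T. (norm (gF t \<omega>))\<^sup>2))"
    by (intro integrable_mult_right Bochner_Integration.integrable_sum)
  have "(\<integral>\<omega>. (\<Sum>t=0..T. (norm (gF t \<omega>))\<^sup>2) \<partial>M) = (\<Sum>t\<le>T. EG t)"
    unfolding EG_def atLeast0AtMost[symmetric] by (rule Bochner_Integration.integral_sum[OF int])
  then show "(\<integral>\<omega>. 1 / (real T + 1) * (\<Sum>t=0..T. (norm (gF t \<omega>))\<^sup>2) \<partial>M) = (\<Sum>t\<le>T. EG t) / (real T + 1)"
    by simp
qed

text \<open>Here the momentum is measured against \<open>grad_x (x t) (y t)\<close>. Returning to
  \<open>grad_F (x t)\<close> doubles the momentum error and adds twice the bias, hence the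
  coefficients 2 and \<open>2 + 1\<close>.\<close>

lemma error_average:
  defines "e \<equiv> \<lambda>t \<omega>. (norm (v (Suc t) \<omega> - gx t \<omega>))\<^sup>2 + L\<^sub>f\<^sup>2 * (norm (y t \<omega> - p t \<omega>))\<^sup>2"
  shows "integrable M (\<lambda>\<omega>. 1 / (real T + 1) * (\<Sum>t=0..T. e t \<omega>))"
    "(\<integral>\<omega>. 1 / (real T + 1) * (\<Sum>t=0..T. e t \<omega>) \<partial>M)
      \<le> (2 * (\<Sum>t\<le>T. EA t) + 3 * (L\<^sub>f\<^sup>2 * (\<Sum>t\<le>T. ED t))) / (real T + 1)"
proof -
  have int: "integrable M (e t)" if "t \<in> {0..T}" for t
    using that unfolding e_def
    by (intro Bochner_Integration.integrable_add integrable_mult_right square_integrableD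
        square_integrable_diff square_integrable_iterates gap_square_integrable) auto
  then show "integrable M (\<lambda>\<omega>. 1 / (real T + 1) * (\<Sum>t=0..T. e t \<omega>))"
    by (intro integrable_mult_right Bochner_Integration.integrable_sum)
  have le: "(\<integral>\<omega>. e t \<omega> \<partial>M) \<le> 2 * EA t + 3 * (L\<^sub>f\<^sup>2 * ED t)" if t: "t \<in> {0..T}" for t
  proof -
    have t': "t \<le> T" "t \<le> Suc T" using t by auto
    have "(\<integral>\<omega>. e t \<omega> \<partial>M) \<le> (\<integral>\<omega>. 2 * (norm (v (Suc t) \<omega> - gF t \<omega>))\<^sup>2 + 3 * (L\<^sub>f\<^sup>2 * (norm (y t \<omega> - p t \<omega>))\<^sup>2) \<partial>M)"
    proof (rule integral_mono[OF int[OF t]])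
      show "integrable M (\<lambda>\<omega>. 2 * (norm (v (Suc t) \<omega> - gF t \<omega>))\<^sup>2 + 3 * (L\<^sub>f\<^sup>2 * (norm (y t \<omega> - p t \<omega>))\<^sup>2))"
        by (intro Bochner_Integration.integrable_add integrable_mult_right square_integrableD
            momentum_error_square_integrable gap_square_integrable t')
      fix \<omega> assume \<omega>: "\<omega> \<in> space M"
      have "(norm (gF t \<omega> - gx t \<omega>))\<^sup>2 \<le> L\<^sub>f\<^sup>2 * (norm (y t \<omega> - p t \<omega>))\<^sup>2"
        using power_mono[OF grad_x_error[OF y_in_Y[OF t'(2) \<omega>], of "x t \<omega>"] norm_ge_zero, of 2]
        by (simp add: power_mult_distrib norm_minus_commute)
      then show "e t \<omega> \<le> 2 * (norm (v (Suc t) \<omega> - gF t \<omega>))\<^sup>2 + 3 * (L\<^sub>f\<^sup>2 * (norm (y t \<omega> - p t \<omega>))\<^sup>2)"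
        using norm_add_square_le[of "v (Suc t) \<omega> - gF t \<omega>" "gF t \<omega> - gx t \<omega>"] by (simp add: e_def)
    qed
    also have "\<dots> = 2 * EA t + 3 * (L\<^sub>f\<^sup>2 * ED t)"
      using square_integrableD(2)[OF momentum_error_square_integrable[OF t'(1)]]
        square_integrableD(2)[OF gap_square_integrable[OF t'(2)]]
      by (simp add: EA_def ED_def)
    finally show ?thesis .
  qed
  have "(\<integral>\<omega>. (\<Sum>t=0..T. e t \<omega>) \<partial>M) = (\<Sum>t=0..T. \<integral>\<omega>. e t \<omega> \<partial>M)"
    by (rule Bochner_Integration.integral_sum[OF int])
  also have "\<dots> \<le> (\<Sum>t=0..T. 2 * EA t + 3 * (L\<^sub>f\<^sup>2 * ED t))"
    by (rule sum_mono[OF le])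
  also have "\<dots> = 2 * (\<Sum>t\<le>T. EA t) + 3 * (L\<^sub>f\<^sup>2 * (\<Sum>t\<le>T. ED t))"
    by (simp add: sum.distrib sum_distrib_left atLeast0AtMost)
  finally show "(\<integral>\<omega>. 1 / (real T + 1) * (\<Sum>t=0..T. e t \<omega>) \<partial>M)
      \<le> (2 * (\<Sum>t\<le>T. EA t) + 3 * (L\<^sub>f\<^sup>2 * (\<Sum>t\<le>T. ED t))) / (real T + 1)"
    by (simp add: divide_right_mono)
qed

lemma initial_dual_error: "p\<^sub>0 \<in> maximizers x\<^sub>0 \<Longrightarrow> ED 0 \<le> (norm (y\<^sub>0 - p\<^sub>0))\<^sup>2"
proof -
  assume "p\<^sub>0 \<in> maximizers x\<^sub>0"
  have "ED 0 = (\<integral>\<omega>. (norm (y\<^sub>0 - ystar x\<^sub>0 y\<^sub>0))\<^sup>2 \<partial>M)"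
    unfolding ED_def by (rule Bochner_Integration.integral_cong) (simp_all add: init)
  also have "\<dots> = (norm (y\<^sub>0 - ystar x\<^sub>0 y\<^sub>0))\<^sup>2" by (simp add: prob_space)
  also have "\<dots> \<le> (norm (y\<^sub>0 - p\<^sub>0))\<^sup>2"
    using ystar_le[OF \<open>p\<^sub>0 \<in> maximizers x\<^sub>0\<close>] by (intro power_mono) auto
  finally show ?thesis .
qed

lemma initial_momentum_error: "EA 0 = (\<integral>\<omega>. (norm (v 1 \<omega> - grad_F x\<^sub>0))\<^sup>2 \<partial>M)"
  unfolding EA_def by (rule Bochner_Integration.integral_cong) (simp_all add: init)

end

section \<open>The convergence rate\<close>

theorem theorem9:
  fixes f :: "real^'d \<Rightarrow> real^'e \<Rightarrow> real"
    and grad_x :: "real^'d \<Rightarrow> real^'e \<Rightarrow> real^'d"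
    and grad_y :: "real^'d \<Rightarrow> real^'e \<Rightarrow> real^'e"
    and grad_F :: "real^'d \<Rightarrow> real^'d"
    and Y :: "(real^'e) set"
    and x\<^sub>0 v\<^sub>0 x\<^sub>m\<^sub>i\<^sub>n :: "real^'d" and y\<^sub>0 :: "real^'e"
    and L\<^sub>F L\<^sub>f \<mu> \<kappa> \<kappa>\<^sub>0 \<sigma> \<Delta>\<^sub>F c\<^sub>l c\<^sub>u G\<^sub>0 D\<^sub>v D\<^sub>y :: real
  assumes "\<And>x. GDERIV (primal_function f Y) x :> grad_F x"
    and "L\<^sub>F-lipschitz_on UNIV grad_F"
    and "has_gradient_on f grad_x grad_y Y"
    and "L\<^sub>f-lipschitz_on (UNIV \<times> Y) (\<lambda>z. (grad_x (fst z) (snd z), grad_y (fst z) (snd z)))"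
    and "0 < \<mu>"
    and "(closed Y \<and> convex Y \<and> (\<forall>x. strongly_concave_on \<mu> Y (f x))) \<or>
         (Y = UNIV \<and> (\<forall>x. concave_on UNIV (f x) \<and> dual_PL \<mu> f grad_y x))"
    and "\<And>x. \<exists>p. is_arg_max (f x) (\<lambda>y. y \<in> Y) p"
    and "is_arg_min (primal_function f Y) (\<lambda>_. True) x\<^sub>m\<^sub>i\<^sub>n"
    and "primal_function f Y x\<^sub>0 - primal_function f Y x\<^sub>m\<^sub>i\<^sub>n \<le> \<Delta>\<^sub>F"
    and "y\<^sub>0 \<in> Y"
    and "\<exists>p. is_arg_max (f x\<^sub>0) (\<lambda>y. y \<in> Y) p \<and> (norm (y\<^sub>0 - p))\<^sup>2 \<le> D\<^sub>y"
    and "0 < c\<^sub>l" and "c\<^sub>l < c\<^sub>u" and "0 \<le> G\<^sub>0"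
    and "\<kappa> = L\<^sub>f / \<mu>" and "0 < \<kappa>\<^sub>0" and "\<kappa>\<^sub>0 \<le> \<kappa>"
  shows "\<exists>T\<^sub>0. \<forall>T\<ge>T\<^sub>0. \<forall>(M :: 'w measure) F \<gamma> \<eta>\<^sub>x \<eta>\<^sub>y Ox Oy h x v u y.
           \<gamma> = sqrt \<kappa> / sqrt (real T) \<longrightarrow>
           \<eta>\<^sub>x = step_const \<kappa>\<^sub>0 L\<^sub>f c\<^sub>l c\<^sub>u / (\<kappa> powr (3/2) * sqrt (real T)) \<longrightarrow>
           \<eta>\<^sub>y = sqrt \<kappa> / sqrt (real T) \<longrightarrow>
           pdsm_run M F Y grad_x grad_y \<sigma> x\<^sub>0 v\<^sub>0 y\<^sub>0 (1 - \<gamma>) \<eta>\<^sub>x \<eta>\<^sub>y G\<^sub>0 c\<^sub>l c\<^sub>u T Ox Oy h x v u y \<longrightarrow>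
           (\<integral>\<omega>. (norm (v 1 \<omega> - grad_F x\<^sub>0))\<^sup>2 \<partial>M) \<le> D\<^sub>v \<longrightarrow>
           (let C = rate_const \<kappa>\<^sub>0 L\<^sub>f \<sigma> c\<^sub>l c\<^sub>u \<Delta>\<^sub>F D\<^sub>v D\<^sub>y;
                G = (\<lambda>\<omega>. 1 / (real T + 1) * (\<Sum>t=0..T. (norm (grad_F (x t \<omega>)))\<^sup>2))
            in integrable M G \<and>
               (\<integral>\<omega>. G \<omega> \<partial>M) \<le> C * (\<kappa> powr (3/2) / sqrt (real T)) \<and>
               (\<exists>ystar :: nat \<Rightarrow> 'w \<Rightarrow> real^'e.
                  (\<forall>t\<le>T. ystar t \<in> borel_measurable M \<and>
                     (\<forall>\<omega>\<in>space M. is_arg_max (f (x t \<omega>)) (\<lambda>y. y \<in> Y) (ystar t \<omega>))) \<and>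
                  (let E = (\<lambda>\<omega>. 1 / (real T + 1) * (\<Sum>t=0..T.
                         (norm (v (Suc t) \<omega> - grad_x (x t \<omega>) (y t \<omega>)))\<^sup>2
                         + L\<^sub>f\<^sup>2 * (norm (y t \<omega> - ystar t \<omega>))\<^sup>2))
                   in integrable M E \<and>
                      (\<integral>\<omega>. E \<omega> \<partial>M) \<le> C * (\<kappa> powr (3/2) / sqrt (real T)))))"
proof -
  define w where "w = sqrt \<kappa>"
  define s where "s = step_const \<kappa>\<^sub>0 L\<^sub>f c\<^sub>l c\<^sub>u"
  define K where "K = 1 + 1 / \<kappa>\<^sub>0"
  note mu_pos = assms(5) and cl = assms(12) and kappa = assms(15)
  have cu: "0 < c\<^sub>u" using assms(12,13) by simp
  interpret P: minimax_problem f grad_x grad_y grad_F Y L\<^sub>F L\<^sub>f \<mu>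
    by unfold_locales (use assms in blast)+
  have kappa_pos: "0 < \<kappa>" using assms(16,17) by simp
  then have w0: "0 < w" and w2: "w\<^sup>2 = \<kappa>" by (simp_all add: w_def)
  have L_eq: "L\<^sub>f = w\<^sup>2 * \<mu>" using mu_pos kappa w2 by simp
  have s0: "0 < s" unfolding s_def using cl cu by (rule step_const_pos)
  have s2: "s\<^sup>2 * c\<^sub>u\<^sup>2 = c\<^sub>l / c\<^sub>u / (2 ^ 14 + 64 * K ^ 4 * L\<^sub>f\<^sup>2)"
  proof -
    let ?d = "2 ^ 14 + 64 * K ^ 4 * L\<^sub>f\<^sup>2"
    have d: "0 < ?d" by (intro add_pos_nonneg) auto
    then have "s\<^sup>2 = c\<^sub>l / (c\<^sub>u ^ 3 * ?d)"
      unfolding s_def step_const_def K_def[symmetric] using cl cu by (intro real_sqrt_pow2) simp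
    then show ?thesis using cu d by (simp add: power3_eq_cube power2_eq_square)
  qed
  have powr: "\<kappa> powr (3/2) = w ^ 3"
    using kappa_pos by (simp add: powr_three_halves w_def)
  obtain p\<^sub>0 where p0: "p\<^sub>0 \<in> P.maximizers x\<^sub>0" "(norm (y\<^sub>0 - p\<^sub>0))\<^sup>2 \<le> D\<^sub>y"
    using assms(11) by (auto simp: P.maximizers_def)
  then have Dy0: "0 \<le> D\<^sub>y" using zero_le_power2 order_trans by blast
  have lower: "primal_function f Y x\<^sub>0 - primal_function f Y z \<le> \<Delta>\<^sub>F" for z
    using assms(8,9) unfolding is_arg_min_def by (smt (verit))
  then have Delta0: "0 \<le> \<Delta>\<^sub>F" using lower[of x\<^sub>0] by simp
  \<comment> \<open>Each summand after the 1 is a lower bound on \<open>sqrt T\<close> for one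
    step-size restriction: \<open>\<gamma> \<le> 1\<close>, then the two on
    \<open>\<eta>\<^sub>y\<close>, then the one on \<open>\<eta>\<^sub>x\<close>. The 1 keeps
    \<open>T\<close> positive. \<open>L\<^sub>F\<close> thus affects \<open>T\<^sub>0\<close> but
    not the rate.\<close>
  define a where "a = 1 + w + w * \<mu> + 4 * w * L\<^sub>f\<^sup>2 / \<mu> + 4 * s * L\<^sub>F * c\<^sub>u\<^sup>2 / (c\<^sub>l * w ^ 3)"
  have LF0: "0 \<le> L\<^sub>F" using P.grad_F_lipschitz_on lipschitz_on_nonneg by blast
  have terms: "0 \<le> w * \<mu>" "0 \<le> 4 * w * L\<^sub>f\<^sup>2 / \<mu>" "0 \<le> 4 * s * L\<^sub>F * c\<^sub>u\<^sup>2 / (c\<^sub>l * w ^ 3)"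
    using w0 mu_pos s0 cl LF0 by simp_all
  obtain T\<^sub>0 :: nat where T0: "a\<^sup>2 \<le> real T\<^sub>0" using real_arch_simple by blast
  show ?thesis
  proof (intro exI[of _ T\<^sub>0] allI impI)
    fix T :: nat and M :: "'w measure" and F \<gamma> \<eta>\<^sub>x \<eta>\<^sub>y Ox Oy h x v u y
    assume T: "T\<^sub>0 \<le> T" and \<gamma>: "\<gamma> = sqrt \<kappa> / sqrt (real T)"
      and \<eta>x: "\<eta>\<^sub>x = step_const \<kappa>\<^sub>0 L\<^sub>f c\<^sub>l c\<^sub>u / (\<kappa> powr (3/2) * sqrt (real T))"
      and \<eta>y: "\<eta>\<^sub>y = sqrt \<kappa> / sqrt (real T)"
      and run: "pdsm_run M F Y grad_x grad_y \<sigma> x\<^sub>0 v\<^sub>0 y\<^sub>0 (1 - \<gamma>) \<eta>\<^sub>x \<eta>\<^sub>y G\<^sub>0 c\<^sub>l c\<^sub>u T Ox Oy h x v u y"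
      and Dv: "(\<integral>\<omega>. (norm (v 1 \<omega> - grad_F x\<^sub>0))\<^sup>2 \<partial>M) \<le> D\<^sub>v"
    define n where "n = sqrt (real T)"
    have "a \<le> n"
      unfolding n_def using T0 T by (intro real_le_rsqrt) linarith
    then have n: "1 \<le> n" "w \<le> n" "w * \<mu> \<le> n" "4 * w * L\<^sub>f\<^sup>2 / \<mu> \<le> n"
      "4 * s * L\<^sub>F * c\<^sub>u\<^sup>2 / (c\<^sub>l * w ^ 3) \<le> n"
      using w0 terms unfolding a_def by linarith+
    then have n0: "0 < n" by simp
    have n2: "n\<^sup>2 = real T" by (simp add: n_def)
    have \<gamma>': "\<gamma> = w / n" and \<eta>y': "\<eta>\<^sub>y = w / n" and \<eta>x': "\<eta>\<^sub>x = s / (w ^ 3 * n)"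
      using \<gamma> \<eta>y \<eta>x by (simp_all add: w_def n_def s_def powr[unfolded w_def])
    interpret pdsm_run M F Y grad_x grad_y \<sigma> x\<^sub>0 v\<^sub>0 y\<^sub>0 "1 - \<gamma>" \<eta>\<^sub>x \<eta>\<^sub>y G\<^sub>0 c\<^sub>l c\<^sub>u T Ox Oy h x v u y
      by (rule run)
    interpret A: pdsm_analysis f grad_x grad_y grad_F Y L\<^sub>F L\<^sub>f \<mu> M F \<sigma> x\<^sub>0 v\<^sub>0 y\<^sub>0 \<gamma> \<eta>\<^sub>x \<eta>\<^sub>y G\<^sub>0 c\<^sub>l c\<^sub>u T Ox Oy h x v u y
    proof unfold_locales
      show "y\<^sub>0 \<in> Y" by (rule assms(10))
      show "0 < \<gamma>" "0 < \<eta>\<^sub>x" "0 < \<eta>\<^sub>y" using w0 n0 s0 by (simp_all add: \<gamma>' \<eta>y' \<eta>x')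
      show "\<gamma> \<le> 1" "\<eta>\<^sub>y * \<mu> \<le> 1" using n n0 by (simp_all add: \<gamma>' \<eta>y' divide_le_eq)
      show "0 < c\<^sub>l" "0 < c\<^sub>u" using cl cu by auto
      show "\<eta>\<^sub>y * L\<^sub>f\<^sup>2 \<le> \<mu> / 4" using n(4) n0 mu_pos by (simp add: \<eta>y' field_simps)
      show "\<eta>\<^sub>x * L\<^sub>F * c\<^sub>u\<^sup>2 \<le> c\<^sub>l / 4" using n(5) n0 cl w0 by (simp add: \<eta>x' field_simps)
    qed
    let ?C = "rate_const \<kappa>\<^sub>0 L\<^sub>f \<sigma> c\<^sub>l c\<^sub>u \<Delta>\<^sub>F D\<^sub>v D\<^sub>y"
    have C: "?C = 16 * (c\<^sub>u / c\<^sub>l) * (64 * (K\<^sup>2 * D\<^sub>v + K * \<sigma>\<^sup>2 + K * L\<^sub>f * D\<^sub>y + L\<^sub>f * \<sigma>\<^sup>2) + \<Delta>\<^sub>F / (c\<^sub>u * s))"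
      by (simp add: rate_const_def Let_def K_def s_def)
    have EA0: "A.EA 0 \<le> D\<^sub>v" using Dv by (simp add: A.initial_momentum_error)
    then have Dv0: "0 \<le> D\<^sub>v" using A.EA_nonneg[of 0] by simp
    have ED0: "A.ED 0 \<le> D\<^sub>y" using A.initial_dual_error[OF p0(1)] p0(2) by simp
    have bounds: "(\<Sum>t\<le>T. A.EG t) \<le> ?C * (w ^ 3 * n)"
      "2 * (\<Sum>t\<le>T. A.EA t) + 3 * (L\<^sub>f\<^sup>2 * (\<Sum>t\<le>T. A.ED t)) \<le> ?C * (w ^ 3 * n)" "0 \<le> ?C"
      unfolding C
    proof (atomize(full), intro conjI)
      have kw: "L\<^sub>f / \<mu> = w\<^sup>2" using kappa w2 by simp
      note hyps = w0 n0 mu_pos s0 cl less_imp_le[OF assms(13)] assms(16) assms(17)[folded w2] Dv0 Dy0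
        sum_nonneg[of "{..T}" A.EB, OF A.EB_nonneg] sum_nonneg[of "{..T}" A.EG, OF A.EG_nonneg]
        Delta0 L_eq K_def s2
      have A: "(w / n) / 2 * (\<Sum>t\<le>T. A.EA t) \<le> D\<^sub>v + ((2 / (w / n)) * ((L\<^sub>f * (1 + 2 * w\<^sup>2))\<^sup>2 * (s / (w ^ 3 * n) * c\<^sub>u)\<^sup>2 * (\<Sum>t\<le>T. A.EB t))
          + (w / n) * (L\<^sub>f\<^sup>2 * (\<Sum>t\<le>T. A.ED t)) + (w / n)\<^sup>2 * \<sigma>\<^sup>2 * n\<^sup>2)"
        using A.momentum_error_sum EA0 unfolding \<gamma>' \<eta>x' kw n2 by linarith
      have D: "(w / n * \<mu>) / 2 * (\<Sum>t\<le>T. A.ED t) \<le> D\<^sub>y + (2 * (w / n)\<^sup>2 * \<sigma>\<^sup>2 * n\<^sup>2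
          + (20 / (w / n * \<mu>)) * ((w\<^sup>2)\<^sup>2 * (s / (w ^ 3 * n) * c\<^sub>u)\<^sup>2 * (\<Sum>t\<le>T. A.EB t)))"
        using A.dual_error_sum ED0 unfolding \<eta>y' \<eta>x' kw n2 by linarith
      note G = A.descent_sum[OF lower, unfolded \<eta>x']
      note result = pdsm_constants[OF hyps A D G]
      show "(\<Sum>t\<le>T. A.EG t) \<le> 16 * (c\<^sub>u / c\<^sub>l) * (64 * (K\<^sup>2 * D\<^sub>v + K * \<sigma>\<^sup>2 + K * L\<^sub>f * D\<^sub>y + L\<^sub>f * \<sigma>\<^sup>2) + \<Delta>\<^sub>F / (c\<^sub>u * s)) * (w ^ 3 * n)"
        by (rule result(1))
      show "2 * (\<Sum>t\<le>T. A.EA t) + 3 * (L\<^sub>f\<^sup>2 * (\<Sum>t\<le>T. A.ED t)) \<le> 16 * (c\<^sub>u / c\<^sub>l) * (64 * (K\<^sup>2 * D\<^sub>v + K * \<sigma>\<^sup>2 + K * L\<^sub>f * D\<^sub>y + L\<^sub>f * \<sigma>\<^sup>2) + \<Delta>\<^sub>F / (c\<^sub>u * s)) * (w ^ 3 * n)"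
        by (rule result(2))
      show "0 \<le> 16 * (c\<^sub>u / c\<^sub>l) * (64 * (K\<^sup>2 * D\<^sub>v + K * \<sigma>\<^sup>2 + K * L\<^sub>f * D\<^sub>y + L\<^sub>f * \<sigma>\<^sup>2) + \<Delta>\<^sub>F / (c\<^sub>u * s))"
        by (rule result(3))
    qed
    \<comment> \<open>The common bound \<open>w ^ 3 * n\<close> on the sums becomes
      \<open>w ^ 3 / n\<close> after division by \<open>n^2 = T\<close>; the extra 1 in the
      denominator only helps.\<close>
    have average: "S / (real T + 1) \<le> ?C * (\<kappa> powr (3/2) / sqrt (real T))"
      if "S \<le> ?C * (w ^ 3 * n)" for S
    proof -
      have "S / (real T + 1) \<le> ?C * (w ^ 3 * n) / (n\<^sup>2 + 1)"
        using that by (simp add: n2 divide_right_mono)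
      also have "\<dots> \<le> ?C * (w ^ 3 * n) / n\<^sup>2"
        using bounds(3) w0 n0 by (intro divide_left_mono mult_nonneg_nonneg mult_pos_pos add_pos_pos) auto
      also have "\<dots> = ?C * (\<kappa> powr (3/2) / sqrt (real T))"
        using n0 by (simp add: powr n_def[symmetric] power2_eq_square)
      finally show ?thesis .
    qed
    show "let C = rate_const \<kappa>\<^sub>0 L\<^sub>f \<sigma> c\<^sub>l c\<^sub>u \<Delta>\<^sub>F D\<^sub>v D\<^sub>y;
                G = (\<lambda>\<omega>. 1 / (real T + 1) * (\<Sum>t=0..T. (norm (grad_F (x t \<omega>)))\<^sup>2))
            in integrable M G \<and>
               (\<integral>\<omega>. G \<omega> \<partial>M) \<le> C * (\<kappa> powr (3/2) / sqrt (real T)) \<and>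
               (\<exists>ystar :: nat \<Rightarrow> 'w \<Rightarrow> real^'e.
                  (\<forall>t\<le>T. ystar t \<in> borel_measurable M \<and>
                     (\<forall>\<omega>\<in>space M. is_arg_max (f (x t \<omega>)) (\<lambda>y. y \<in> Y) (ystar t \<omega>))) \<and>
                  (let E = (\<lambda>\<omega>. 1 / (real T + 1) * (\<Sum>t=0..T.
                         (norm (v (Suc t) \<omega> - grad_x (x t \<omega>) (y t \<omega>)))\<^sup>2
                         + L\<^sub>f\<^sup>2 * (norm (y t \<omega> - ystar t \<omega>))\<^sup>2))
                   in integrable M E \<and>
                      (\<integral>\<omega>. E \<omega> \<partial>M) \<le> C * (\<kappa> powr (3/2) / sqrt (real T))))"
      unfolding Let_def
    \<comment> \<open>The selection of maximizers is the closest one along the run; its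
      measurability comes from the continuity of \<open>ystar\<close>.\<close>
    proof (intro conjI exI[of _ A.p] allI impI ballI)
      show "(\<integral>\<omega>. 1 / (real T + 1) * (\<Sum>t=0..T. (norm (grad_F (x t \<omega>)))\<^sup>2) \<partial>M)
          \<le> ?C * (\<kappa> powr (3/2) / sqrt (real T))"
        unfolding A.gradient_average(2) by (rule average[OF bounds(1)])
      show "A.p t \<in> borel_measurable M" if "t \<le> T" for t
        using that by (intro A.measurable_F_M[OF A.p_adapted]) simp
      show "is_arg_max (f (x t \<omega>)) (\<lambda>y. y \<in> Y) (A.p t \<omega>)" for t \<omega>
        using P.ystar_maximizer by (simp add: P.maximizers_def)
      show "(\<integral>\<omega>. 1 / (real T + 1) * (\<Sum>t=0..T. (norm (v (Suc t) \<omega> - grad_x (x t \<omega>) (y t \<omega>)))\<^sup>2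
          + L\<^sub>f\<^sup>2 * (norm (y t \<omega> - A.p t \<omega>))\<^sup>2) \<partial>M) \<le> ?C * (\<kappa> powr (3/2) / sqrt (real T))"
        using A.error_average(2) average[OF bounds(2)] by (rule order_trans)
    qed (rule A.gradient_average(1) A.error_average(1))+
  qed
qed

end
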